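(* Let $K$ be a field with $\operatorname{char}(K)\neq 2$, let $a,b\in K$, and suppose that $f(x)=x^6+ax^3+b$ is irreducible and separable over $K$. Put $\Delta=a^2-4b$ and $R(x)=x^3-3bx+ab\in K[x]$, and let $F$ be the splitting field of $f(x)$ over $K$. Let $\zeta_3$ denote a primitive cubic root of unity. Then: 1. When $\zeta_3\notin K$ and $-3\Delta$ is not a square in $K$: - if $\sqrt[3]{b}\in K$ or $R(x)$ is reducible over $K$, then $\operatorname{Gal}(F/K)\cong D_6$; - if $\sqrt[3]{b}\notin K$ and $R(x)$ is irreducible over $K$, then $\operatorname{Gal}(F/K)\cong S_3\times S_3$. 2. When $\zeta_3\notin K$ and $-3\Delta$ is a square in $K$: - if $\sqrt[3]{b}\in K$ and $R(x)$ is irreducible over $K$, then $\operatorname{Gal}(F/K)\cong C_6$; - if $\sqrt[3]{b}\notin K$ and $R(x)$ is reducible over $K$, then $\operatorname{Gal}(F/K)\cong S_3$; - if $\sqrt[3]{b}\notin K$ and $R(x)$ is irreducible over $K$, then $\operatorname{Gal}(F/K)\cong C_3\times S_3$. 3. When $\zeta_3\in K$: - if $\sqrt[3]{b}\in K$ and $R(x)$ is irreducible over $K$, then $\operatorname{Gal}(F/K)\cong S_3$; - if $\sqrt[3]{b}\notin K$ and $R(x)$ is reducible over $K$, then $\operatorname{Gal}(F/K)\cong C_6$; - if $\sqrt[3]{b}\notin K$ and $R(x)$ is irreducible over $K$, then $\operatorname{Gal}(F/K)\cong C_3\times S_3$. These are all the possible cases, i.e. every such $f$ falls into one of the cases liste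d.
   Context: "$\sqrt[3]{b}\in K$" means that at least one cubic root of $b$ (in an algebraic closure of $K$) belongs to $K$; "$\sqrt[3]{b}\notin K$" means that none of the cubic roots of $b$ belongs to $K$. $D_6$ is the dihedral group of order $12$, $C_n$ the cyclic group of order $n$, $S_3$ the symmetric group on $3$ letters. A polynomial is separable if it has no repeated roots in an algebraic closure. *)

theory Defs
  imports
    "HOL-Computational_Algebra.Computational_Algebra"
    "HOL-Algebra.Algebra"
    "HOL-Algebra.Algebraic_Closure_Type"
begin

text \<open>
  The base field \<open>K\<close> is a type \<open>'a\<close> of class \<open>field\<close>; everything else takes place inside its
  algebraic closure \<open>'a alg_closure\<close>, in which \<open>K\<close> is identified with the range of \<open>to_ac\<close>.
\<close>

abbreviation closure_ring :: "'a::field alg_closure ring" where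
  "closure_ring \<equiv> ring_of_type_algebra"

abbreviation base_field :: "'a::field alg_closure set" where
  "base_field \<equiv> range to_ac"

definition splitting_field :: "'a::field poly \<Rightarrow> 'a alg_closure set" where
  "splitting_field p =
     generate_field closure_ring (base_field \<union> {x. poly (map_poly to_ac p) x = 0})"

definition separable :: "'a::field poly \<Rightarrow> bool" where
  "separable p \<longleftrightarrow> rsquarefree (map_poly to_ac p)"

text \<open>
  For subfields \<open>K \<subseteq> F\<close> of \<open>L\<close>: the field automorphisms of \<open>F\<close> that fix \<open>K\<close> pointwise, under
  composition. As in \<open>BijGroup\<close>, automorphisms of \<open>F\<close> are represented by functions that are
  \<open>undefined\<close> outside \<open>F\<close>, so that each one is counted once.
\<close>
definition galois_group :: "('e, 'm) ring_scheme \<Rightarrow> 'e set \<Rightarrow> 'e set \<Rightarrow> ('e \<Rightarrow> 'e) monoid" where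
  "galois_group L F K = BijGroup F
     \<lparr>carrier := {\<sigma> \<in> Bij F. \<sigma> \<in> ring_hom (L\<lparr>carrier := F\<rparr>) (L\<lparr>carrier := F\<rparr>) \<and> (\<forall>x\<in>K. \<sigma> x = x)}\<rparr>"

definition primitive_root_of_unity :: "nat \<Rightarrow> 'e::field \<Rightarrow> bool" where
  "primitive_root_of_unity n z \<longleftrightarrow> n > 0 \<and> z ^ n = 1 \<and> (\<forall>k. 0 < k \<and> k < n \<longrightarrow> z ^ k \<noteq> 1)"

definition cube_root_in_base :: "'a::field \<Rightarrow> bool" where
  "cube_root_in_base b \<longleftrightarrow> (\<exists>c::'a alg_closure. c ^ 3 = to_ac b \<and> c \<in> base_field)"

text \<open>
  The dihedral group of order \<open>2 * n\<close> (for \<open>n > 0\<close>), where \<open>(i, s)\<close> stands for \<open>r\<^sup>i\<close> if \<open>s\<close> is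
  false and for \<open>r\<^sup>i t\<close> if \<open>s\<close> is true; here \<open>r\<close> is a rotation of order \<open>n\<close> and \<open>t\<close> is a
  reflection, so that \<open>t r t = r\<^sup>-\<^sup>1\<close>.
\<close>
definition dihedral_group :: "nat \<Rightarrow> (int \<times> bool) monoid" where
  "dihedral_group n =
     \<lparr>carrier = {0..<int n} \<times> UNIV,
      monoid.mult = (\<lambda>(i, s) (j, t). ((if s then i - j else i + j) mod int n, s \<noteq> t)),
      one = (0, False)\<rparr>"

lemma group_dihedral_group:
  assumes "n > 0"
  shows "group (dihedral_group n)"
proof (rule groupI)
  fix x y z
  assume "x \<in> carrier (dihedral_group n)" "y \<in> carrier (dihedral_group n)"
    "z \<in> carrier (dihedral_group n)"
  show "x \<otimes>\<^bsub>dihedral_group n\<^esub> y \<otimes>\<^bsub>dihedral_group n\<^esub> z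
        = x \<otimes>\<^bsub>dihedral_group n\<^esub> (y \<otimes>\<^bsub>dihedral_group n\<^esub> z)"
    by (auto simp: dihedral_group_def mod_simps algebra_simps split: prod.splits)
next
  fix x
  assume "x \<in> carrier (dihedral_group n)"
  then obtain i s where x: "x = (i, s)" and i: "0 \<le> i" "i < int n"
    by (auto simp: dihedral_group_def)
  have "(if s then (i, s) else ((- i) mod int n, s)) \<otimes>\<^bsub>dihedral_group n\<^esub> x
        = \<one>\<^bsub>dihedral_group n\<^esub>"
    by (simp add: dihedral_group_def x mod_simps)
  moreover have "(if s then (i, s) else ((- i) mod int n, s)) \<in> carrier (dihedral_group n)"
    using assms i by (simp add: dihedral_group_def)
  ultimately show "\<exists>y\<in>carrier (dihedral_group n). y \<otimes>\<^bsub>dihedral_group n\<^esub> x = \<one>\<^bsub>dihedral_group n\<^esub>"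
    by blast
qed (use assms in \<open>auto simp: dihedral_group_def\<close>)

lemma order_dihedral_group: "Coset.order (dihedral_group n) = 2 * n"
  by (simp add: Coset.order_def dihedral_group_def card_cartesian_product)

lemma subfield_splitting_field: "subfield (splitting_field p) closure_ring"
  unfolding splitting_field_def
  by (rule field.generate_field_is_subfield[OF field_from_type_algebra])
     (simp add: ring_of_type_algebra_def)

lemma group_galois_group:
  assumes "field L" "subfield F L" "K \<subseteq> F"
  shows "group (galois_group L F K)"
proof -
  define A where "A = {\<sigma> \<in> Bij F. \<sigma> \<in> ring_hom (L\<lparr>carrier := F\<rparr>) (L\<lparr>carrier := F\<rparr>) \<and> (\<forall>x\<in>K. \<sigma> x = x)}"
  interpret L: field L by fact
  have F: "subring F L" using assms(2) by (rule subfieldE(1))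
  note Fc = subringE(3,6,7)[OF F]
  have "subgroup A (BijGroup F)"
  proof
    show "A \<subseteq> carrier (BijGroup F)"
      by (auto simp: A_def BijGroup_def)
    show "\<one>\<^bsub>BijGroup F\<^esub> \<in> A"
      using Fc assms(3) by (auto simp: A_def BijGroup_def id_Bij ring_hom_def)
  next
    fix g h assume gh: "g \<in> A" "h \<in> A"
    have "compose F g h \<in> A"
      using gh Fc assms(3) compose_Bij[of g F h]
      by (auto simp: A_def ring_hom_def compose_def Pi_iff subset_iff)
    thus "g \<otimes>\<^bsub>BijGroup F\<^esub> h \<in> A"
      using gh by (simp add: A_def BijGroup_def)
  next
    fix g assume g: "g \<in> A"
    hence gB: "g \<in> Bij F" and inj: "inj_on g F"
      by (auto simp: A_def Bij_def bij_betw_def)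
    let ?g = "\<lambda>x\<in>F. inv_into F g x"
    have mult: "inv_into F g (x \<otimes>\<^bsub>L\<^esub> y) = inv_into F g x \<otimes>\<^bsub>L\<^esub> inv_into F g y"
      if "x \<in> F" "y \<in> F" for x y
      by (rule Bij_inv_into_lemma) (use g gB Fc that in \<open>auto simp: A_def ring_hom_def\<close>)
    have add: "inv_into F g (x \<oplus>\<^bsub>L\<^esub> y) = inv_into F g x \<oplus>\<^bsub>L\<^esub> inv_into F g y"
      if "x \<in> F" "y \<in> F" for x y
      by (rule Bij_inv_into_lemma) (use g gB Fc that in \<open>auto simp: A_def ring_hom_def\<close>)
    have fix1: "inv_into F g x = x" if "g x = x" "x \<in> F" for x
      using inj that by (metis inv_into_f_f)
    have "?g \<in> ring_hom (L\<lparr>carrier := F\<rparr>) (L\<lparr>carrier := F\<rparr>)"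
      using g gB Fc mult add fix1 by (auto simp: A_def ring_hom_def Bij_inv_into_mem)
    moreover have "\<forall>x\<in>K. ?g x = x"
      using g fix1 assms(3) by (auto simp: A_def)
    ultimately have "?g \<in> A"
      using restrict_inv_into_Bij[OF gB] by (simp add: A_def)
    thus "inv\<^bsub>BijGroup F\<^esub> g \<in> A"
      by (simp add: inv_BijGroup[OF gB])
  qed
  thus ?thesis
    unfolding galois_group_def A_def[symmetric]
    by (rule subgroup.subgroup_is_group) (rule group_BijGroup)
qed

end

theory Submission
  imports Defs
begin

text \<open>
  Let \<open>\<alpha>\<^sup>3\<close> and \<open>\<beta>\<^sup>3\<close> be the roots of \<open>y\<^sup>2 + a y + b\<close> and put \<open>c = \<alpha> \<beta>\<close>. Then \<open>c\<^sup>3 = b\<close>, and the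
  roots of \<open>R\<close> are \<open>t\<^sub>i = \<zeta>\<^sup>i \<alpha>\<^sup>2\<beta> + \<zeta>\<^sup>-\<^sup>i \<alpha>\<beta>\<^sup>2\<close>. Since \<open>F\<close> is generated over \<open>K\<close> by the roots of
  \<open>x\<^sup>3 - b\<close> and of \<open>R\<close>, the Galois group embeds into \<open>S\<^sub>3 \<times> S\<^sub>3\<close>. The two sign characters are governed by
  the square classes of \<open>-3\<close> and \<open>-3\<Delta>\<close>, and they differ on some automorphism because \<open>\<Delta>\<close> is not a square.
  Conjugating with such an automorphism splits every rotation of one factor off the image, so the image is
  the full product of its two projections. Finally, \<open>x\<^sup>3 - b\<close> and \<open>R\<close> cannot both have a root in \<open>K\<close>:
  from such roots \<open>c\<close> and \<open>m c\<close> one gets the factor \<open>x\<^sup>2 - m x + c\<close> of \<open>f\<close>.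
\<close>

section \<open>Extending field homomorphisms\<close>

text \<open>Origin of \<open>R\<close>: the sum \<open>m = \<alpha> + \<beta>\<close> satisfies
  \<open>m ^ 3 - 3 * c * m + a = 0\<close>, whose coefficient \<open>c\<close> need not lie in
  \<open>K\<close>. Scaling the roots by \<open>c\<close> and using \<open>c ^ 3 = b\<close> turns
  this cubic into \<open>R\<close>, with root \<open>c * m\<close>. The obstacle is that a subgroup
  of a product may be a proper subdirect product, glued along a common quotient of its two
  projections. A single automorphism with different signs on the two cubics rules this out, so that
  each projection can be computed by itself. A projection is then determined by two bits: whether
  all its signs are even, and whether it fixes the index 0. Galois theory enters through one fact:
  an element of \<open>F\<close> outside \<open>K\<close> that is a root of a separable polynomial
  over \<open>K\<close> is moved by some automorphism. For the second bit to be right, a root in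
  \<open>K\<close> must carry the index 0, in both cubics simultaneously. This is why
  \<open>\<alpha>\<close> and \<open>\<beta>\<close> are constructed from suitable roots of the two
  cubics and not the other way round.\<close>

lemma subfield_type_algebra_iff:
  fixes M :: "'e::field set"
  shows "subfield M ring_of_type_algebra \<longleftrightarrow>
    1 \<in> M \<and> (\<forall>x\<in>M. - x \<in> M \<and> inverse x \<in> M) \<and> (\<forall>x\<in>M. \<forall>y\<in>M. x + y \<in> M \<and> x * y \<in> M)"
    (is "?L \<longleftrightarrow> ?R")
proof -
  interpret E: Ring.field "ring_of_type_algebra :: 'e ring"
    by (rule field_from_type_algebra)
  have um: "\<ominus>\<^bsub>ring_of_type_algebra\<^esub> x = - x" for x :: 'e
    by (rule E.minus_equality) (auto simp: ring_of_type_algebra_def)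
  have iv: "inv\<^bsub>ring_of_type_algebra\<^esub> x = inverse x" if "x \<noteq> 0" for x :: 'e
    by (rule E.comm_inv_char) (use that in \<open>auto simp: ring_of_type_algebra_def\<close>)
  show ?thesis
  proof
    assume L: ?L
    note sr = subringE[OF subfieldE(1)[OF L]]
    have "inverse x \<in> M" if "x \<in> M" for x
      using E.subfield_m_inv(1)[OF L, of x] that iv[of x]
      by (cases "x = 0") (auto simp: ring_of_type_algebra_def)
    moreover have "1 \<in> M" using sr(3) by (simp add: ring_of_type_algebra_def)
    moreover have "- x \<in> M" if "x \<in> M" for x using sr(5)[OF that] by (simp add: um)
    moreover have "x * y \<in> M" "x + y \<in> M" if "x \<in> M" "y \<in> M" for x y
      using sr(6,7)[OF that] by (simp_all add: ring_of_type_algebra_def)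
    ultimately show ?R by (intro conjI ballI)
  next
    assume R: ?R
    have "subring M ring_of_type_algebra"
      by (rule E.subringI) (use R um in \<open>auto simp: ring_of_type_algebra_def\<close>)
    thus ?L
      by (rule E.subfieldI') (use R iv in \<open>auto simp: ring_of_type_algebra_def\<close>)
  qed
qed

lemma
  fixes M :: "'e::field set"
  assumes M: "subfield M ring_of_type_algebra"
  shows subfield_one: "1 \<in> M"
    and subfield_zero: "0 \<in> M"
    and subfield_uminus: "x \<in> M \<Longrightarrow> - x \<in> M"
    and subfield_inverse: "x \<in> M \<Longrightarrow> inverse x \<in> M"
    and subfield_add: "x \<in> M \<Longrightarrow> y \<in> M \<Longrightarrow> x + y \<in> M"
    and subfield_diff: "x \<in> M \<Longrightarrow> y \<in> M \<Longrightarrow> x - y \<in> M"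
    and subfield_mult: "x \<in> M \<Longrightarrow> y \<in> M \<Longrightarrow> x * y \<in> M"
    and subfield_divide: "x \<in> M \<Longrightarrow> y \<in> M \<Longrightarrow> x / y \<in> M"
    and subfield_power: "x \<in> M \<Longrightarrow> x ^ n \<in> M"
proof -
  note * = M[unfolded subfield_type_algebra_iff]
  show 1: "1 \<in> M" using * by blast
  show "0 \<in> M" using * 1 by (metis add.right_inverse)
  show "- x \<in> M" if "x \<in> M" for x using * that by blast
  show "inverse x \<in> M" if "x \<in> M" for x using * that by blast
  show "x + y \<in> M" if "x \<in> M" "y \<in> M" for x y using * that by blast
  show "x - y \<in> M" if "x \<in> M" "y \<in> M" for x y
    using * that by (metis diff_conv_add_uminus)
  show "x * y \<in> M" if "x \<in> M" "y \<in> M" for x y using * that by blast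
  show "x / y \<in> M" if "x \<in> M" "y \<in> M" for x y
    using * that by (metis divide_inverse)
  show "x ^ n \<in> M" if "x \<in> M" for x
    by (induction n) (use * 1 that in auto)
qed

lemmas subfield_closed = subfield_one subfield_zero subfield_uminus subfield_inverse subfield_add
  subfield_diff subfield_mult subfield_divide subfield_power

section \<open>Polynomials with coefficients in a subfield\<close>

lemma subfield_sum:
  fixes M :: "'e::field set"
  assumes M: "subfield M ring_of_type_algebra" and "\<And>i. i \<in> I \<Longrightarrow> g i \<in> M"
  shows "sum g I \<in> M"
  using assms(2) by (induction I rule: infinite_finite_induct) (auto intro: subfield_closed[OF M])

text \<open>A set of polynomials over the surrounding field, not a type of its own, because the
  coefficient field is replaced by larger subfields while a homomorphism is being extended.\<close>

definition polys_over :: "'e::field set \<Rightarrow> 'e poly set" where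
  "polys_over M = {p. \<forall>i. coeff p i \<in> M}"

context
  fixes M :: "'e::field set"
  assumes M: "subfield M ring_of_type_algebra"
begin

lemma polys_over_0: "0 \<in> polys_over M"
  and polys_over_const: "c \<in> M \<Longrightarrow> [:c:] \<in> polys_over M"
  and polys_over_pCons: "c \<in> M \<Longrightarrow> p \<in> polys_over M \<Longrightarrow> pCons c p \<in> polys_over M"
  and polys_over_add: "p \<in> polys_over M \<Longrightarrow> q \<in> polys_over M \<Longrightarrow> p + q \<in> polys_over M"
  and polys_over_diff: "p \<in> polys_over M \<Longrightarrow> q \<in> polys_over M \<Longrightarrow> p - q \<in> polys_over M"
  and polys_over_uminus: "p \<in> polys_over M \<Longrightarrow> - p \<in> polys_over M"
  and polys_over_mult: "p \<in> polys_over M \<Longrightarrow> q \<in> polys_over M \<Longrightarrow> p * q \<in> polys_over M"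
  and polys_over_monom: "c \<in> M \<Longrightarrow> monom c n \<in> polys_over M"
  by (auto simp: polys_over_def coeff_pCons coeff_mult split: nat.splits
      intro!: subfield_closed[OF M] subfield_sum[OF M])

text \<open>Long division: each step subtracts a multiple of \<open>p\<close> by a monomial whose
  coefficient is a quotient of elements of \<open>M\<close>, so nothing leaves
  \<open>M\<close>.\<close>

lemma polys_over_divmod:
  assumes p: "p \<in> polys_over M" "p \<noteq> 0" and q: "q \<in> polys_over M"
  shows "\<exists>s\<in>polys_over M. \<exists>r\<in>polys_over M. q = p * s + r \<and> (r = 0 \<or> degree r < degree p)"
  using q
proof (induction "degree q" arbitrary: q rule: less_induct)
  case less
  show ?case
  proof (cases "q = 0 \<or> degree q < degree p")
    case True
    thus ?thesis using less.prems polys_over_0 by (intro bexI[of _ 0] bexI[of _ q]) auto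
  next
    case False
    define c where "c = lead_coeff q / lead_coeff p"
    define n where "n = degree q - degree p"
    define q' where "q' = q - p * monom c n"
    have c: "c \<in> M" using p less.prems by (auto simp: c_def polys_over_def intro: subfield_closed[OF M])
    have c0: "c \<noteq> 0" using False p by (auto simp: c_def)
    have q': "q' \<in> polys_over M"
      unfolding q'_def by (intro polys_over_diff polys_over_mult polys_over_monom c p less.prems)
    have deg: "degree (p * monom c n) = degree q"
      using False p degree_mult_eq[of p "monom c n"] degree_monom_eq[OF c0, of n] c0
      by (simp add: n_def)
    have lc: "lead_coeff (p * monom c n) = lead_coeff q"
      using p degree_monom_eq[OF c0, of n] by (simp add: lead_coeff_mult) (simp add: c_def)
    show ?thesis
    proof (cases "q' = 0")
      case True
      thus ?thesis using c polys_over_0 polys_over_monom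
        by (intro bexI[of _ "monom c n"] bexI[of _ 0]) (auto simp: q'_def)
    next
      case nz: False
      have le: "degree q' \<le> degree q"
        unfolding q'_def using deg by (metis degree_diff_le order_refl)
      have "coeff q' (degree q) = 0" using lc deg by (simp add: q'_def)
      hence "degree q' < degree q"
        using nz le by (metis leading_coeff_neq_0 le_neq_implies_less)
      from less.hyps[OF this q'] obtain s r where sr: "s \<in> polys_over M" "r \<in> polys_over M"
        "q' = p * s + r" "r = 0 \<or> degree r < degree p" by blast
      show ?thesis
        by (intro bexI[of _ "s + monom c n"] bexI[of _ r])
          (use sr c q'_def in \<open>auto simp: algebra_simps intro: polys_over_add polys_over_monom\<close>)
    qed
  qed
qed

text \<open>A nonzero polynomial of least degree vanishing at \<open>x\<close> is taken. The last
  two properties are the form in which its minimality is used: every relation satisfied by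
  \<open>x\<close> is a multiple of \<open>p\<close>, and the values \<open>poly q x\<close> form a
  field.\<close>

lemma minimal_polynomial:
  assumes "p0 \<in> polys_over M" "p0 \<noteq> 0" "poly p0 x = 0"
  obtains p where "p \<in> polys_over M" "p \<noteq> 0" "poly p x = 0" "degree p > 0"
    "\<forall>q\<in>polys_over M. poly q x = 0 \<longrightarrow> (\<exists>s\<in>polys_over M. q = p * s)"
    "\<forall>q\<in>polys_over M. poly q x \<noteq> 0 \<longrightarrow> (\<exists>w\<in>polys_over M. poly q x * poly w x = 1)"
proof -
  let ?P = "\<lambda>p. p \<in> polys_over M \<and> p \<noteq> 0 \<and> poly p x = 0"
  obtain p where p: "?P p" and mn: "\<And>q. ?P q \<Longrightarrow> degree p \<le> degree q"
    using assms ex_has_least_nat[of ?P p0 degree] by blast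
  have deg: "degree p > 0"
    using p by (metis degree_0_id degree_eq_zeroE gr0I pCons_eq_0_iff mult_zero_right poly_0 poly_pCons add_0_right)
  have small: "r = 0" if "r \<in> polys_over M" "poly r x = 0" "degree r < degree p" for r
    using mn that by force
  have div: "\<exists>s\<in>polys_over M. q = p * s" if q: "q \<in> polys_over M" "poly q x = 0" for q
  proof -
    obtain s r where sr: "s \<in> polys_over M" "r \<in> polys_over M" "q = p * s + r"
      "r = 0 \<or> degree r < degree p" using polys_over_divmod[of p q] p q by blast
    have "poly r x = 0" using sr p q by auto
    hence "r = 0" using small sr by blast
    thus ?thesis using sr by auto
  qed
  \<comment> \<open>Descent on the degree of \<open>q\<close>: from \<open>p = q * s + r\<close> one
    gets \<open>r(x) = - q(x) s(x)\<close>, so an inverse \<open>w\<close> of \<open>r(x)\<close>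
    yields the inverse \<open>- s w\<close> of \<open>q(x)\<close>. If \<open>r = 0\<close>,
    minimality of \<open>p\<close> forces \<open>q\<close> to be constant.\<close>
  have inv_small: "\<exists>w\<in>polys_over M. poly q x * poly w x = 1"
    if "q \<in> polys_over M" "poly q x \<noteq> 0" "degree q < degree p" for q
    using that
  proof (induction "degree q" arbitrary: q rule: less_induct)
    case less
    have q0: "q \<noteq> 0" using less.prems by auto
    obtain s r where sr: "s \<in> polys_over M" "r \<in> polys_over M" "p = q * s + r"
      "r = 0 \<or> degree r < degree q" using polys_over_divmod[of q p] p q0 less.prems by blast
    show ?case
    proof (cases "r = 0")
      case True
      have "s \<noteq> 0" using True sr p by auto
      have "poly s x = 0" using True sr p less.prems by auto
      hence "degree p \<le> degree s" using mn sr \<open>s \<noteq> 0\<close> by blast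
      moreover have "degree p = degree q + degree s"
        using True sr \<open>s \<noteq> 0\<close> q0 by (simp add: degree_mult_eq)
      ultimately have "degree q = 0" by simp
      then obtain c where c: "q = [:c:]" by (metis degree_eq_zeroE)
      hence "c \<in> M" "c \<noteq> 0" using less.prems q0 by (auto simp: polys_over_def coeff_pCons dest: spec[of _ 0])
      thus ?thesis using c
        by (intro bexI[of _ "[:inverse c:]"] polys_over_const) (auto intro: subfield_closed[OF M])
    next
      case False
      hence dr: "degree r < degree q" using sr by blast
      have rx: "poly r x = - (poly q x * poly s x)" using p sr by (simp add: eq_neg_iff_add_eq_0 add.commute)
      have "poly r x \<noteq> 0" using False small[of r] sr dr less.prems by force
      then obtain w where "w \<in> polys_over M" "poly r x * poly w x = 1"
        using less.hyps[OF dr] sr dr less.prems by force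
      thus ?thesis using rx sr
        by (intro bexI[of _ "- (s * w)"]) (auto intro: polys_over_uminus polys_over_mult simp: algebra_simps)
    qed
  qed
  have inv: "\<exists>w\<in>polys_over M. poly q x * poly w x = 1" if q: "q \<in> polys_over M" "poly q x \<noteq> 0" for q
  proof -
    obtain s r where sr: "s \<in> polys_over M" "r \<in> polys_over M" "q = p * s + r"
      "r = 0 \<or> degree r < degree p" using polys_over_divmod[of p q] p q by blast
    hence "poly r x = poly q x" using p by simp
    thus ?thesis using inv_small[of r] sr q by force
  qed
  show ?thesis using that[of p] p deg div inv by blast
qed

end

text \<open>The values may lie anywhere in the surrounding field. Embeddings can thus be extended
  step by step, and bijectivity on a splitting field is settled only at the end.\<close>

definition field_hom_on :: "'e::field set \<Rightarrow> ('e \<Rightarrow> 'e) \<Rightarrow> bool" where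
  "field_hom_on M \<sigma> \<longleftrightarrow> \<sigma> 1 = 1 \<and> (\<forall>x\<in>M. \<forall>y\<in>M. \<sigma> (x + y) = \<sigma> x + \<sigma> y \<and> \<sigma> (x * y) = \<sigma> x * \<sigma> y)"

context
  fixes M :: "'e::field set" and \<sigma> :: "'e \<Rightarrow> 'e"
  assumes M: "subfield M ring_of_type_algebra" and \<sigma>: "field_hom_on M \<sigma>"
begin

lemma field_hom_on_add: "x \<in> M \<Longrightarrow> y \<in> M \<Longrightarrow> \<sigma> (x + y) = \<sigma> x + \<sigma> y"
  and field_hom_on_mult: "x \<in> M \<Longrightarrow> y \<in> M \<Longrightarrow> \<sigma> (x * y) = \<sigma> x * \<sigma> y"
  and field_hom_on_1: "\<sigma> 1 = 1"
  using \<sigma> by (auto simp: field_hom_on_def)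

lemma field_hom_on_0: "\<sigma> 0 = 0"
  using field_hom_on_add[of 0 0] subfield_zero[OF M] by (metis add.right_neutral add_left_cancel)

lemma field_hom_on_uminus: "x \<in> M \<Longrightarrow> \<sigma> (- x) = - \<sigma> x"
  using field_hom_on_add[of x "- x"] subfield_uminus[OF M, of x] field_hom_on_0
  by (simp add: eq_neg_iff_add_eq_0 add.commute)

lemma field_hom_on_diff: "x \<in> M \<Longrightarrow> y \<in> M \<Longrightarrow> \<sigma> (x - y) = \<sigma> x - \<sigma> y"
  using field_hom_on_add[of x "- y"] field_hom_on_uminus[of y] subfield_uminus[OF M, of y] by simp

lemma field_hom_on_eq_0: "x \<in> M \<Longrightarrow> \<sigma> x = 0 \<Longrightarrow> x = 0"
  using field_hom_on_mult[of x "inverse x"] subfield_inverse[OF M, of x] field_hom_on_1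
  by (metis mult_zero_left right_inverse zero_neq_one)

lemma field_hom_on_inj: "inj_on \<sigma> M"
  by (rule inj_onI)
    (metis field_hom_on_diff field_hom_on_eq_0 subfield_diff[OF M] right_minus_eq)

lemma field_hom_on_inverse: "x \<in> M \<Longrightarrow> \<sigma> (inverse x) = inverse (\<sigma> x)"
  using field_hom_on_mult[of x "inverse x"] subfield_inverse[OF M, of x] field_hom_on_1 field_hom_on_0
  by (metis inverse_unique inverse_zero right_inverse)

lemma field_hom_on_power: "x \<in> M \<Longrightarrow> \<sigma> (x ^ n) = \<sigma> x ^ n"
  by (induction n) (auto simp: field_hom_on_1 field_hom_on_mult subfield_closed[OF M])

lemma field_hom_on_sum: "(\<And>i. i \<in> I \<Longrightarrow> g i \<in> M) \<Longrightarrow> \<sigma> (sum g I) = (\<Sum>i\<in>I. \<sigma> (g i))"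
  by (induction I rule: infinite_finite_induct)
    (auto simp: field_hom_on_0 field_hom_on_add subfield_sum[OF M])

lemma map_poly_hom_add:
  "p \<in> polys_over M \<Longrightarrow> q \<in> polys_over M \<Longrightarrow> map_poly \<sigma> (p + q) = map_poly \<sigma> p + map_poly \<sigma> q"
  by (rule poly_eqI) (auto simp: coeff_map_poly field_hom_on_0 field_hom_on_add polys_over_def)

lemma map_poly_hom_diff:
  "p \<in> polys_over M \<Longrightarrow> q \<in> polys_over M \<Longrightarrow> map_poly \<sigma> (p - q) = map_poly \<sigma> p - map_poly \<sigma> q"
  by (rule poly_eqI) (auto simp: coeff_map_poly field_hom_on_0 field_hom_on_diff polys_over_def)

lemma map_poly_hom_mult:
  "p \<in> polys_over M \<Longrightarrow> q \<in> polys_over M \<Longrightarrow> map_poly \<sigma> (p * q) = map_poly \<sigma> p * map_poly \<sigma> q"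
  by (rule poly_eqI)
    (auto simp: coeff_map_poly field_hom_on_0 field_hom_on_mult field_hom_on_sum coeff_mult
      polys_over_def subfield_mult[OF M])

lemma field_hom_on_poly:
  "p \<in> polys_over M \<Longrightarrow> x \<in> M \<Longrightarrow> \<sigma> (poly p x) = poly (map_poly \<sigma> p) (\<sigma> x)"
proof (induction p)
  case (pCons a p)
  have "a \<in> M" "p \<in> polys_over M"
    using pCons.prems by (auto simp: polys_over_def coeff_pCons split: nat.splits)
  moreover from this pCons.prems have "poly p x \<in> M"
    unfolding poly_altdef by (intro subfield_sum[OF M]) (auto simp: polys_over_def intro: subfield_closed[OF M])
  ultimately show ?case using pCons
    by (simp add: map_poly_pCons field_hom_on_0 field_hom_on_add field_hom_on_mult subfield_mult[OF M])
qed (simp add: field_hom_on_0)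

lemma degree_map_poly_hom: "p \<in> polys_over M \<Longrightarrow> degree (map_poly \<sigma> p) = degree p"
  by (cases "p = 0")
    (auto intro!: map_poly_degree_eq simp: polys_over_def dest: field_hom_on_eq_0[rotated])

text \<open>The classical map sending \<open>q(x)\<close> to \<open>(\<sigma> q)(y)\<close>. It is
  well defined because every \<open>q\<close> vanishing at \<open>x\<close> is a multiple of
  \<open>p\<close> and \<open>y\<close> is a root of the transported \<open>p\<close>; the
  assumption \<open>inv\<close> makes the set of all \<open>q(x)\<close> a field.\<close>

lemma extend_hom_simple:
  assumes p: "p \<in> polys_over M" and y: "poly (map_poly \<sigma> p) y = 0"
    and dvd: "\<forall>q\<in>polys_over M. poly q x = 0 \<longrightarrow> (\<exists>s\<in>polys_over M. q = p * s)"
    and inv: "\<forall>q\<in>polys_over M. poly q x \<noteq> 0 \<longrightarrow> (\<exists>w\<in>polys_over M. poly q x * poly w x = 1)"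
  obtains N \<tau> where "subfield N ring_of_type_algebra" "field_hom_on N \<tau>" "M \<subseteq> N" "x \<in> N"
    "\<forall>z\<in>M. \<tau> z = \<sigma> z" "\<tau> x = y"
proof -
  define N where "N = (\<lambda>q. poly q x) ` polys_over M"
  \<comment> \<open>A representing polynomial is picked by choice; the fact \<open>\<tau>\<close>
    below shows that every representative gives the same value.\<close>
  define \<tau> where "\<tau> z = poly (map_poly \<sigma> (SOME q. q \<in> polys_over M \<and> poly q x = z)) y" for z
  have \<tau>: "\<tau> (poly q x) = poly (map_poly \<sigma> q) y" if q: "q \<in> polys_over M" for q
  proof -
    define q' where "q' = (SOME q'. q' \<in> polys_over M \<and> poly q' x = poly q x)"
    have q': "q' \<in> polys_over M \<and> poly q' x = poly q x"
      unfolding q'_def by (rule someI[of _ q]) (use q in auto)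
    hence "poly (q' - q) x = 0" "q' - q \<in> polys_over M" using q by (auto intro: polys_over_diff[OF M])
    then obtain s where "s \<in> polys_over M" "q' - q = p * s" using dvd by blast
    hence "poly (map_poly \<sigma> (q' - q)) y = 0" using p y by (simp add: map_poly_hom_mult)
    thus ?thesis using q q' unfolding \<tau>_def q'_def[symmetric] by (simp add: map_poly_hom_diff)
  qed
  have inN: "poly q x \<in> N" if "q \<in> polys_over M" for q using that by (auto simp: N_def)
  have "subfield N ring_of_type_algebra"
    unfolding subfield_type_algebra_iff
  proof (intro conjI ballI)
    show "1 \<in> N" using inN[OF polys_over_const[OF M subfield_one[OF M]]] by simp
    fix z assume "z \<in> N"
    then obtain q where q: "q \<in> polys_over M" "z = poly q x" by (auto simp: N_def)
    show "- z \<in> N" using inN[OF polys_over_uminus[OF M q(1)]] q by simp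
    show "inverse z \<in> N"
    proof (cases "z = 0")
      case True
      thus ?thesis using inN[OF polys_over_0[OF M]] by simp
    next
      case False
      then obtain w where "w \<in> polys_over M" "z * poly w x = 1" using inv q by blast
      thus ?thesis using inN inverse_unique by metis
    qed
    fix z' assume "z' \<in> N"
    then obtain q' where q': "q' \<in> polys_over M" "z' = poly q' x" by (auto simp: N_def)
    show "z + z' \<in> N" "z * z' \<in> N"
      using inN[OF polys_over_add[OF M q(1) q'(1)]] inN[OF polys_over_mult[OF M q(1) q'(1)]] q q' by auto
  qed
  moreover have "field_hom_on N \<tau>"
    unfolding field_hom_on_def
  proof (intro conjI ballI)
    show "\<tau> 1 = 1" using \<tau>[OF polys_over_const[OF M subfield_one[OF M]]]
      by (simp add: map_poly_pCons field_hom_on_0 field_hom_on_1)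
    fix z z' assume "z \<in> N" "z' \<in> N"
    then obtain q q' where q: "q \<in> polys_over M" "z = poly q x" and q': "q' \<in> polys_over M" "z' = poly q' x"
      by (auto simp: N_def)
    show "\<tau> (z + z') = \<tau> z + \<tau> z'"
      using \<tau>[OF polys_over_add[OF M q(1) q'(1)]] q q' by (simp add: \<tau> map_poly_hom_add)
    show "\<tau> (z * z') = \<tau> z * \<tau> z'"
      using \<tau>[OF polys_over_mult[OF M q(1) q'(1)]] q q' by (simp add: \<tau> map_poly_hom_mult)
  qed
  moreover have "z \<in> N" "\<tau> z = \<sigma> z" if "z \<in> M" for z
    using inN[OF polys_over_const[OF M that]] \<tau>[OF polys_over_const[OF M that]]
    by (simp_all add: map_poly_pCons field_hom_on_0)
  moreover have "x \<in> N" "\<tau> x = y"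
    using inN[of "[:0,1:]"] \<tau>[of "[:0,1:]"]
      polys_over_pCons[OF M subfield_zero[OF M] polys_over_const[OF M subfield_one[OF M]]]
    by (simp_all add: map_poly_pCons field_hom_on_0 field_hom_on_1)
  ultimately show ?thesis using that[of N \<tau>] by blast
qed

end

text \<open>The elements are adjoined one at a time. Algebraic closedness provides a root of the
  transported minimal polynomial, so the target never has to grow.\<close>

lemma extend_hom_finite:
  fixes M :: "'e::alg_closed_field set"
  assumes M: "subfield M ring_of_type_algebra" and \<sigma>: "field_hom_on M \<sigma>"
    and S: "finite S" "\<And>x. x \<in> S \<Longrightarrow> \<exists>p\<in>polys_over M. p \<noteq> 0 \<and> poly p x = 0"
  obtains N \<tau> where "subfield N ring_of_type_algebra" "field_hom_on N \<tau>" "M \<subseteq> N" "S \<subseteq> N"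
    "\<forall>z\<in>M. \<tau> z = \<sigma> z"
proof -
  have "\<exists>N \<tau>. subfield N ring_of_type_algebra \<and> field_hom_on N \<tau> \<and> M \<subseteq> N \<and> S \<subseteq> N \<and> (\<forall>z\<in>M. \<tau> z = \<sigma> z)"
    using S
  proof (induction S rule: finite_induct)
    case empty
    thus ?case using M \<sigma> by blast
  next
    case (insert x S)
    then obtain N \<tau> where N: "subfield N ring_of_type_algebra" "field_hom_on N \<tau>" "M \<subseteq> N" "S \<subseteq> N"
      "\<And>z. z \<in> M \<Longrightarrow> \<tau> z = \<sigma> z" by blast
    obtain p0 where "p0 \<in> polys_over M" "p0 \<noteq> 0" "poly p0 x = 0" using insert.prems by blast
    hence "p0 \<in> polys_over N" "p0 \<noteq> 0" "poly p0 x = 0" using N(3) by (auto simp: polys_over_def)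
    then obtain p where p: "p \<in> polys_over N" "p \<noteq> 0" "poly p x = 0" "degree p > 0"
      "\<forall>q\<in>polys_over N. poly q x = 0 \<longrightarrow> (\<exists>s\<in>polys_over N. q = p * s)"
      "\<forall>q\<in>polys_over N. poly q x \<noteq> 0 \<longrightarrow> (\<exists>w\<in>polys_over N. poly q x * poly w x = 1)"
      by (rule minimal_polynomial[OF N(1)])
    obtain y where y: "poly (map_poly \<tau> p) y = 0"
      using alg_closed_imp_poly_has_root[of "map_poly \<tau> p"] p degree_map_poly_hom[OF N(1,2) p(1)] by auto
    obtain N' \<tau>' where
      "subfield N' ring_of_type_algebra" "field_hom_on N' \<tau>'" "N \<subseteq> N'" "x \<in> N'"
      "\<forall>z\<in>N. \<tau>' z = \<tau> z" "\<tau>' x = y"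
      by (rule extend_hom_simple[OF N(1,2) p(1) y p(5,6)])
    thus ?case using N by (intro exI[of _ N'] exI[of _ \<tau>']) auto
  qed
  thus ?thesis using that by blast
qed

section \<open>The Galois group of a splitting field\<close>

lemma subfield_base_field: "subfield (base_field :: 'a::field alg_closure set) closure_ring"
  unfolding subfield_type_algebra_iff
proof (intro conjI ballI)
  show "1 \<in> base_field" by (metis rangeI to_ac_1)
  fix x :: "'a alg_closure" assume "x \<in> base_field"
  then obtain u where u: "x = to_ac u" by blast
  show "- x \<in> base_field" "inverse x \<in> base_field"
    unfolding u by (metis rangeI to_ac_minus, metis rangeI to_ac_inverse)
  fix y :: "'a alg_closure" assume "y \<in> base_field"
  then obtain v where v: "y = to_ac v" by blast
  show "x + y \<in> base_field" "x * y \<in> base_field"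
    unfolding u v by (metis rangeI to_ac_add, metis rangeI to_ac_mult)
qed

lemma map_poly_to_ac_over: "map_poly to_ac p \<in> polys_over base_field"
  by (auto simp: polys_over_def coeff_map_poly)

lemma map_poly_to_ac_eq_0_iff: "map_poly to_ac p = 0 \<longleftrightarrow> p = 0"
  by (auto simp: poly_eq_iff coeff_map_poly)

lemma poly_map_poly_to_ac: "poly (map_poly to_ac p) (to_ac x) = to_ac (poly p x)"
  by (induction p) (simp_all add: map_poly_pCons)

lemma base_subset_splitting_field: "base_field \<subseteq> splitting_field p"
  unfolding splitting_field_def by (blast intro: generate_field.incl)

lemma root_in_splitting_field: "poly (map_poly to_ac p) x = 0 \<Longrightarrow> x \<in> splitting_field p"
  unfolding splitting_field_def by (blast intro: generate_field.incl)

lemma splitting_field_minimal: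
  assumes "subfield M closure_ring" "base_field \<subseteq> M" "\<And>x. poly (map_poly to_ac p) x = 0 \<Longrightarrow> x \<in> M"
  shows "splitting_field p \<subseteq> M"
  unfolding splitting_field_def
  by (rule field.generate_field_min_subfield1[OF field_from_type_algebra])
    (use assms in \<open>auto simp: ring_of_type_algebra_def\<close>)

section \<open>Automorphisms of a splitting field\<close>

lemma galois_groupD:
  assumes "\<sigma> \<in> carrier (galois_group closure_ring F base_field)" "subfield F closure_ring"
  shows "field_hom_on F \<sigma>" "\<And>x. x \<in> base_field \<Longrightarrow> \<sigma> x = x" "\<And>x. x \<in> F \<Longrightarrow> \<sigma> x \<in> F"
  using assms subfield_one[OF subfield_base_field]
  by (auto simp: galois_group_def BijGroup_def field_hom_on_def ring_hom_def ring_of_type_algebra_def)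

lemma galois_group_mult:
  assumes "\<sigma> \<in> carrier (galois_group closure_ring F base_field)"
    "\<tau> \<in> carrier (galois_group closure_ring F base_field)"
  shows "\<sigma> \<otimes>\<^bsub>galois_group closure_ring F base_field\<^esub> \<tau> = compose F \<sigma> \<tau>"
  using assms by (auto simp: galois_group_def BijGroup_def)

lemma galois_group_eqI:
  assumes "\<sigma> \<in> carrier (galois_group closure_ring F base_field)"
    "\<tau> \<in> carrier (galois_group closure_ring F base_field)" "\<And>x. x \<in> F \<Longrightarrow> \<sigma> x = \<tau> x"
  shows "\<sigma> = \<tau>"
  using assms by (intro extensionalityI[of _ F]) (auto simp: galois_group_def Bij_def)

lemma hom_fixing_base_root:
  assumes M: "subfield M closure_ring" "base_field \<subseteq> M" and \<sigma>: "field_hom_on M \<sigma>"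
    "\<And>x. x \<in> base_field \<Longrightarrow> \<sigma> x = x"
    and x: "x \<in> M" "poly (map_poly to_ac p) x = 0"
  shows "poly (map_poly to_ac p) (\<sigma> x) = 0"
proof -
  have p: "map_poly to_ac p \<in> polys_over M"
    using map_poly_to_ac_over[of p] M(2) by (auto simp: polys_over_def)
  have "map_poly \<sigma> (map_poly to_ac p) = map_poly to_ac p"
    by (rule poly_eqI) (simp add: coeff_map_poly field_hom_on_0[OF M(1) \<sigma>(1)] \<sigma>(2))
  thus ?thesis using field_hom_on_poly[OF M(1) \<sigma>(1) p x(1)] x(2) field_hom_on_0[OF M(1) \<sigma>(1)] by simp
qed

text \<open>Normality of splitting fields. An injective map of the finite root set of
  \<open>f\<close> into itself is a permutation, so both the image of \<open>F\<close> and the set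
  of elements sent into \<open>F\<close> are subfields containing the generators of
  \<open>F\<close>.\<close>

lemma galois_group_restrict:
  fixes f :: "'a::field poly"
  assumes f: "f \<noteq> 0"
    and M: "subfield M closure_ring" "splitting_field f \<subseteq> M"
    and \<sigma>: "field_hom_on M \<sigma>" "\<And>x. x \<in> base_field \<Longrightarrow> \<sigma> x = x"
  shows "restrict \<sigma> (splitting_field f) \<in> carrier (galois_group closure_ring (splitting_field f) base_field)"
proof -
  let ?F = "splitting_field f"
  note F = subfield_splitting_field[of f]
  note KF = base_subset_splitting_field[of f]
  have \<sigma>F: "field_hom_on ?F \<sigma>" using \<sigma>(1) M(2) by (auto simp: field_hom_on_def)
  note h = field_hom_on_1[OF F \<sigma>F] field_hom_on_0[OF F \<sigma>F] field_hom_on_uminus[OF F \<sigma>F]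
    field_hom_on_inverse[OF F \<sigma>F] field_hom_on_add[OF F \<sigma>F] field_hom_on_mult[OF F \<sigma>F]
  have img_subfield: "subfield (\<sigma> ` ?F) closure_ring"
    unfolding subfield_type_algebra_iff
  proof (intro conjI ballI)
    show "1 \<in> \<sigma> ` ?F" using h(1) subfield_one[OF F] by (metis imageI)
    fix x assume "x \<in> \<sigma> ` ?F"
    then obtain u where u: "x = \<sigma> u" "u \<in> ?F" by blast
    show "- x \<in> \<sigma> ` ?F" "inverse x \<in> \<sigma> ` ?F"
      using u h(3,4) subfield_uminus[OF F u(2)] subfield_inverse[OF F u(2)] by (metis imageI)+
    fix y assume "y \<in> \<sigma> ` ?F"
    then obtain v where v: "y = \<sigma> v" "v \<in> ?F" by blast
    show "x + y \<in> \<sigma> ` ?F" "x * y \<in> \<sigma> ` ?F"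
      using u v h(5,6) subfield_add[OF F u(2) v(2)] subfield_mult[OF F u(2) v(2)] by (metis imageI)+
  qed
  define Z where "Z = {x. poly (map_poly to_ac f) x = 0}"
  have Z: "Z \<subseteq> ?F" by (auto simp: Z_def intro: root_in_splitting_field)
  have finZ: "finite Z" unfolding Z_def using f by (intro poly_roots_finite) (simp add: map_poly_to_ac_eq_0_iff)
  have "\<sigma> ` Z \<subseteq> Z"
    using hom_fixing_base_root[OF F KF \<sigma>F \<sigma>(2)] Z by (auto simp: Z_def)
  hence \<sigma>Z: "\<sigma> ` Z = Z"
    using finZ Z field_hom_on_inj[OF F \<sigma>F] by (metis endo_inj_surj inj_on_subset)
  have "?F \<subseteq> \<sigma> ` ?F"
  proof (rule splitting_field_minimal[OF img_subfield])
    show "base_field \<subseteq> \<sigma> ` ?F"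
    proof
      fix x :: "'a alg_closure" assume x: "x \<in> base_field"
      hence "\<sigma> x \<in> \<sigma> ` ?F" using KF by blast
      thus "x \<in> \<sigma> ` ?F" by (simp only: \<sigma>(2)[OF x])
    qed
    show "x \<in> \<sigma> ` ?F" if "poly (map_poly to_ac f) x = 0" for x
    proof -
      have "x \<in> \<sigma> ` Z" using that unfolding \<sigma>Z by (simp add: Z_def)
      thus ?thesis using Z by blast
    qed
  qed
  moreover have img: "\<sigma> ` ?F \<subseteq> ?F"
  proof -
    have "?F \<subseteq> {x \<in> ?F. \<sigma> x \<in> ?F}"
    proof (rule splitting_field_minimal)
      show "subfield {x \<in> ?F. \<sigma> x \<in> ?F} closure_ring"
        unfolding subfield_type_algebra_iff
        by (intro conjI ballI CollectI) (simp_all add: h subfield_closed[OF F])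
      show "base_field \<subseteq> {x \<in> ?F. \<sigma> x \<in> ?F}"
      proof
        fix x :: "'a alg_closure" assume x: "x \<in> base_field"
        hence "x \<in> ?F" using KF by blast
        thus "x \<in> {x \<in> ?F. \<sigma> x \<in> ?F}" by (simp add: \<sigma>(2)[OF x])
      qed
      show "x \<in> {x \<in> ?F. \<sigma> x \<in> ?F}" if "poly (map_poly to_ac f) x = 0" for x
      proof -
        have "x \<in> Z" "\<sigma> x \<in> Z" using that \<sigma>Z by (auto simp: Z_def)
        thus ?thesis using Z by blast
      qed
    qed
    thus ?thesis by blast
  qed
  ultimately have bij: "bij_betw \<sigma> ?F ?F"
    using field_hom_on_inj[OF F \<sigma>F] unfolding bij_betw_def by blast
  let ?g = "restrict \<sigma> ?F"
  have "?g \<in> Bij ?F" unfolding Bij_def using bij by (simp cong: bij_betw_cong)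
  moreover have "?g \<in> ring_hom (closure_ring\<lparr>carrier := ?F\<rparr>) (closure_ring\<lparr>carrier := ?F\<rparr>)"
    by (rule ring_hom_memI)
      (use img in \<open>auto simp: ring_of_type_algebra_def h subfield_closed[OF F]\<close>)
  moreover have "?g x = x" if "x \<in> base_field" for x
    using that KF \<sigma>(2)[OF that] by (metis restrict_apply' subsetD)
  ultimately show ?thesis by (simp add: galois_group_def)
qed

text \<open>The minimal polynomial of \<open>x\<close> divides \<open>p\<close>; as \<open>x\<close>
  is not in \<open>K\<close>, it has a further root \<open>y\<close>, which differs from
  \<open>x\<close> by separability. The embedding with \<open>x \<mapsto> y\<close> extends to the
  roots of \<open>f\<close> and restricts to an automorphism of the splitting field.\<close>

lemma splitting_field_fixed:
  assumes f: "f \<noteq> 0" and x: "x \<notin> base_field" and p: "separable p" "poly (map_poly to_ac p) x = 0"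
    and xF: "x \<in> splitting_field f"
  obtains \<sigma> where "\<sigma> \<in> carrier (galois_group closure_ring (splitting_field f) base_field)" "\<sigma> x \<noteq> x"
proof -
  note K = subfield_base_field
  have p0: "map_poly to_ac p \<noteq> 0" using p by (auto simp: separable_def rsquarefree_def)
  obtain m where m: "m \<in> polys_over base_field" "m \<noteq> 0" "poly m x = 0" "degree m > 0"
    "\<forall>q\<in>polys_over base_field. poly q x = 0 \<longrightarrow> (\<exists>s\<in>polys_over base_field. q = m * s)"
    "\<forall>q\<in>polys_over base_field. poly q x \<noteq> 0 \<longrightarrow> (\<exists>w\<in>polys_over base_field. poly q x * poly w x = 1)"
    by (rule minimal_polynomial[OF K map_poly_to_ac_over p0 p(2)])
  obtain m' where m': "m = [:- x, 1:] * m'" using m(3) poly_eq_0_iff_dvd by (metis dvdE)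
  \<comment> \<open>With a constant cofactor \<open>m\<close> would be linear, and \<open>x\<close>
    would be a quotient of its coefficients up to sign, hence in \<open>K\<close>.\<close>
  have "degree m' > 0"
  proof (rule ccontr)
    assume "\<not> degree m' > 0"
    then obtain c where c: "m' = [:c:]" by (metis degree_eq_zeroE gr0I)
    hence "c \<noteq> 0" using m' m(2) by auto
    have "coeff m 0 = - (x * c)" "coeff m 1 = c" using m' c by (auto simp: coeff_pCons)
    hence xc: "- (x * c) \<in> base_field" "c \<in> base_field" using m(1) by (auto simp: polys_over_def) metis+
    show False using subfield_divide[OF K subfield_uminus[OF K xc(1)] xc(2)] x \<open>c \<noteq> 0\<close> by simp
  qed
  then obtain y where y: "poly m' y = 0" using alg_closed_imp_poly_has_root by blast
  have "y \<noteq> x"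
  proof
    assume "y = x"
    hence "[:- x, 1:] dvd m'" using y poly_eq_0_iff_dvd by blast
    moreover obtain s where "map_poly to_ac p = m * s" using m(5) map_poly_to_ac_over p(2) by blast
    ultimately have "[:- x, 1:] ^ 2 dvd map_poly to_ac p"
      unfolding m' power2_eq_square by (metis dvd_mult2 mult_dvd_mono dvd_refl)
    hence "order x (map_poly to_ac p) \<ge> 2" using p0 by (simp add: order_divides)
    thus False using p(1) unfolding separable_def rsquarefree_def by (metis not_numeral_le_zero numeral_le_one_iff semiring_norm(69))
  qed
  have id: "field_hom_on base_field (\<lambda>x. x)" by (simp add: field_hom_on_def)
  have my: "poly (map_poly (\<lambda>x. x) m) y = 0" using m' y by (simp add: map_poly_idI)
  obtain N \<tau> where N: "subfield N closure_ring" "field_hom_on N \<tau>" "base_field \<subseteq> N" "x \<in> N"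
    "\<forall>z\<in>base_field. \<tau> z = z" "\<tau> x = y"
    by (rule extend_hom_simple[OF K id m(1) my m(5,6)])
  define Z where "Z = {x. poly (map_poly to_ac f) x = 0}"
  have f0: "map_poly to_ac f \<noteq> 0" using f by (simp add: map_poly_to_ac_eq_0_iff)
  have "finite Z" unfolding Z_def using f0 by (rule poly_roots_finite)
  moreover have "\<exists>p\<in>polys_over N. p \<noteq> 0 \<and> poly p z = 0" if "z \<in> Z" for z
    by (rule bexI[of _ "map_poly to_ac f"])
      (use that f0 N(3) map_poly_to_ac_over[of f] in \<open>auto simp: Z_def polys_over_def\<close>)
  ultimately obtain M \<sigma> where M: "subfield M closure_ring" "field_hom_on M \<sigma>" "N \<subseteq> M" "Z \<subseteq> M"
    "\<forall>z\<in>N. \<sigma> z = \<tau> z"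
    by (rule extend_hom_finite[OF N(1,2)])
  have "splitting_field f \<subseteq> M"
    by (rule splitting_field_minimal[OF M(1)]) (use M N in \<open>auto simp: Z_def\<close>)
  from galois_group_restrict[OF f M(1) this M(2)] M(3,5) N(3,5)
  have "restrict \<sigma> (splitting_field f) \<in> carrier (galois_group closure_ring (splitting_field f) base_field)"
    by (metis subsetD)
  moreover have "restrict \<sigma> (splitting_field f) x \<noteq> x"
    using xF bspec[OF M(5) N(4)] N(6) \<open>y \<noteq> x\<close> by simp
  ultimately show ?thesis using that by blast
qed

section \<open>Subgroups of the square of the dihedral group of order six\<close>

lemma int_less_3_cases: "0 \<le> x \<Longrightarrow> x < 3 \<Longrightarrow> x = 0 \<or> x = 1 \<or> x = 2" for x :: int
  by linarith

lemma int_mod_3_cases: "x mod 3 = 0 \<or> x mod 3 = 1 \<or> x mod 3 = 2" for x :: int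
  by (rule int_less_3_cases) simp_all

lemma atLeastLessThan_int_numeral:
  "{0..<2::int} = {0,1}" "{0..<3::int} = {0,1,2}" "{0..<6::int} = {0,1,2,3,4,5}"
  by auto

definition dihedral_act :: "int \<times> bool \<Rightarrow> int \<Rightarrow> int" where
  "dihedral_act d x = (if snd d then fst d - x else fst d + x)"

lemma dihedral_act_mult:
  "dihedral_act (d \<otimes>\<^bsub>dihedral_group 3\<^esub> d') x mod 3 = dihedral_act d (dihedral_act d' x) mod 3"
  by (cases d; cases d'; cases "snd d"; cases "snd d'")
    (simp_all add: dihedral_act_def dihedral_group_def mod_simps, simp_all add: algebra_simps)

lemma dihedral_act_mod: "dihedral_act d x mod 3 = dihedral_act d (x mod 3) mod 3"
  by (simp add: dihedral_act_def mod_simps)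

text \<open>
  With \<open>dihedral_act\<close>, the group \<open>dihedral_group 3\<close> acts on the integers modulo 3. The flag \<open>E\<close> restricts
  to even permutations, the flag \<open>T\<close> to the stabilizer of 0.
\<close>

definition D3_subset :: "bool \<Rightarrow> bool \<Rightarrow> (int \<times> bool) set" where
  "D3_subset E T = {d \<in> carrier (dihedral_group 3). (E \<longrightarrow> \<not> snd d) \<and> (T \<longrightarrow> fst d = 0)}"

abbreviation D3_sub :: "bool \<Rightarrow> bool \<Rightarrow> (int \<times> bool) monoid" where
  "D3_sub E T \<equiv> dihedral_group 3 \<lparr>carrier := D3_subset E T\<rparr>"

lemma subgroup_D3_subset: "subgroup (D3_subset E T) (dihedral_group 3)"
proof -
  interpret group "dihedral_group 3" by (rule group_dihedral_group) simp
  show ?thesis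
  proof (rule subgroupI)
    fix d assume d: "d \<in> D3_subset E T"
    have "inv\<^bsub>dihedral_group 3\<^esub> d = (if snd d then d else ((- fst d) mod 3, False))"
      by (rule inv_equality) (use d in \<open>auto simp: D3_subset_def dihedral_group_def mod_simps\<close>)
    thus "inv\<^bsub>dihedral_group 3\<^esub> d \<in> D3_subset E T"
      using d by (auto simp: D3_subset_def dihedral_group_def)
  qed (auto simp: D3_subset_def dihedral_group_def)
qed

lemmas group_D3_sub = subgroup.subgroup_is_group[OF subgroup_D3_subset group_dihedral_group, simplified]

lemma D3_sub_carriers:
  "D3_subset True True = {(0, False)}"
  "D3_subset True False = {0, 1, 2} \<times> {False}"
  "D3_subset False True = {0} \<times> {False, True}"
  "D3_subset False False = {0, 1, 2} \<times> {False, True}"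
  by (auto simp: D3_subset_def dihedral_group_def)

section \<open>Isomorphism types of products of the standard subgroups\<close>

lemma int_mod_6:
  fixes i :: int
  shows "i mod 6 mod 3 = i mod 3" "even (i mod 6) \<longleftrightarrow> even i"
  by (simp_all add: mod_mod_cancel dvd_mod_iff)

lemma D3_sub_iso_integer_mod_group_3: "D3_sub True False \<cong> integer_mod_group 3"
proof -
  have "(\<lambda>i. (i, False)) \<in> iso (integer_mod_group 3) (D3_sub True False)"
    by (auto simp: iso_def hom_def carrier_integer_mod_group D3_subset_def dihedral_group_def
        bij_betw_def inj_on_def)
  thus ?thesis by (intro group.iso_sym[OF group_integer_mod_group]) (auto simp: is_iso_def)
qed

text \<open>Chinese remainder theorem; the factor of order two is realized by the reflection
  \<open>(0, True)\<close>.\<close>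

lemma D3_sub_iso_integer_mod_group_6: "D3_sub False True \<times>\<times> D3_sub True False \<cong> integer_mod_group 6"
proof -
  have "(\<lambda>i. ((0, odd i), (i mod 3, False))) \<in> iso (integer_mod_group 6) (D3_sub False True \<times>\<times> D3_sub True False)"
    unfolding iso_def
  proof (intro CollectI conjI)
    show "(\<lambda>i. ((0, odd i), (i mod 3, False))) \<in> hom (integer_mod_group 6) (D3_sub False True \<times>\<times> D3_sub True False)"
      by (auto simp: hom_def carrier_integer_mod_group D3_subset_def dihedral_group_def
          int_mod_6 mod_simps)
    show "bij_betw (\<lambda>i. ((0, odd i), (i mod 3, False))) (carrier (integer_mod_group 6))
      (carrier (D3_sub False True \<times>\<times> D3_sub True False))"
      \<comment> \<open>The coefficients are the idempotents modulo 6: 3 is 1 modulo 2 and 0 modulo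
        3, while 4 is 0 modulo 2 and 1 modulo 3.\<close>
      by (rule bij_betw_byWitness[where f' = "\<lambda>((_, s), (k, _)). (3 * of_bool s + 4 * k) mod 6"])
        (auto simp: carrier_integer_mod_group D3_sub_carriers atLeastLessThan_int_numeral)
  qed
  thus ?thesis by (intro group.iso_sym[OF group_integer_mod_group]) (auto simp: is_iso_def)
qed

text \<open>Chinese remainder theorem on the rotation index. Its parity is multiplicative even
  across reflections, since \<open>i - j\<close> and \<open>i + j\<close> have the same parity; so a
  factor of order two splits off. Surjectivity follows by counting twelve elements on both
  sides.\<close>

lemma D3_sub_iso_dihedral_group_6: "D3_sub False True \<times>\<times> D3_sub False False \<cong> dihedral_group 6"
proof -
  have "(\<lambda>(i, s). ((0, odd i), (i mod 3, s))) \<in> iso (dihedral_group 6) (D3_sub False True \<times>\<times> D3_sub False False)"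
    unfolding iso_def
  proof (intro CollectI conjI)
    show "(\<lambda>(i, s). ((0, odd i), (i mod 3, s))) \<in> hom (dihedral_group 6) (D3_sub False True \<times>\<times> D3_sub False False)"
      by (auto simp: hom_def D3_subset_def dihedral_group_def int_mod_6 mod_simps)
    have "inj_on (\<lambda>(i, s). ((0::int, odd i), (i mod 3, s))) (carrier (dihedral_group 6))"
    proof (rule inj_onI)
      fix x y :: "int \<times> bool"
      assume *: "x \<in> carrier (dihedral_group 6)" "y \<in> carrier (dihedral_group 6)"
        "(\<lambda>(i, s). ((0::int, odd i), (i mod 3, s))) x = (\<lambda>(i, s). ((0, odd i), (i mod 3, s))) y"
      hence "fst x \<in> {0,1,2,3,4,5}" "fst y \<in> {0,1,2,3,4,5}"
        by (auto simp: dihedral_group_def simp flip: atLeastLessThan_int_numeral)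
      moreover have "odd (fst x) = odd (fst y)" "fst x mod 3 = fst y mod 3" "snd x = snd y"
        using *(3) by (auto simp: case_prod_beta)
      ultimately have "fst x = fst y" by auto
      thus "x = y" using \<open>snd x = snd y\<close> by (rule prod_eqI)
    qed
    moreover have "(\<lambda>(i, s). ((0, odd i), (i mod 3, s))) ` carrier (dihedral_group 6)
        = carrier (D3_sub False True \<times>\<times> D3_sub False False)"
    proof (rule card_subset_eq)
      show "card ((\<lambda>(i, s). ((0::int, odd i), (i mod 3, s))) ` carrier (dihedral_group 6))
          = card (carrier (D3_sub False True \<times>\<times> D3_sub False False))"
        unfolding card_image[OF calculation]
        by (simp add: D3_sub_carriers dihedral_group_def card_cartesian_product)
    qed (auto simp: D3_subset_def dihedral_group_def)
    ultimately show "bij_betw (\<lambda>(i, s). ((0, odd i), (i mod 3, s))) (carrier (dihedral_group 6))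
        (carrier (D3_sub False True \<times>\<times> D3_sub False False))"
      by (simp add: bij_betw_def)
  qed
  thus ?thesis by (intro group.iso_sym[OF group_dihedral_group]) (auto simp: is_iso_def)
qed

lemma D3_sub_iso_sym_group_3: "D3_sub False False \<cong> sym_group 3"
proof -
  \<comment> \<open>\<open>sym_group 3\<close> permutes 1, 2, 3, whereas the action is on residues
    modulo 3. The shift by one picks the representatives 1, 2, 3, so 3 stands for the residue
    0.\<close>
  define g :: "int \<times> bool \<Rightarrow> nat \<Rightarrow> nat"
    where "g d i = (if i \<in> {1..3} then nat ((dihedral_act d (int i) - 1) mod 3) + 1 else i)" for d i
  have D3: "carrier (D3_sub False False) = {0,1,2} \<times> {False, True}"
    by (auto simp: D3_subset_def dihedral_group_def)
  have i3: "{1..3::nat} = {1,2,3}" by auto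
  have g_hom: "g (d \<otimes>\<^bsub>dihedral_group 3\<^esub> d') = g d \<circ> g d'"
    if "d \<in> {0,1,2} \<times> {False, True}" "d' \<in> {0,1,2} \<times> {False, True}" for d d'
  proof
    fix i
    show "g (d \<otimes>\<^bsub>dihedral_group 3\<^esub> d') i = (g d \<circ> g d') i"
    proof (cases "i \<in> {1..3}")
      case True
      hence "g d' i \<in> {1..3}" by (auto simp: g_def nat_le_iff)
      moreover have "int (g d' i) = (dihedral_act d' (int i) - 1) mod 3 + 1"
        using True by (simp add: g_def)
      moreover have "(dihedral_act (d \<otimes>\<^bsub>dihedral_group 3\<^esub> d') (int i) - 1) mod 3
        = (dihedral_act d ((dihedral_act d' (int i) - 1) mod 3 + 1) - 1) mod 3"
      proof (rule mod_diff_cong)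
        let ?y = "dihedral_act d' (int i)"
        have "((?y - 1) mod 3 + 1) mod 3 = ?y mod 3" by (simp add: mod_simps)
        thus "dihedral_act (d \<otimes>\<^bsub>dihedral_group 3\<^esub> d') (int i) mod 3
          = dihedral_act d ((?y - 1) mod 3 + 1) mod 3"
          unfolding dihedral_act_mult by (metis dihedral_act_mod)
      qed simp
      ultimately show ?thesis using True by (simp add: g_def add.commute)
    qed (auto simp: g_def)
  qed
  have "g d permutes {1..3}" if "d \<in> {0,1,2} \<times> {False, True}" for d
  proof -
    define d' where "d' = (if snd d then d else ((- fst d) mod 3, False))"
    have d': "d' \<in> {0,1,2} \<times> {False, True}" using that by (auto simp: d'_def)
    have "g (0, False) = id" by (auto simp: g_def fun_eq_iff dihedral_act_def)
    moreover have "d \<otimes>\<^bsub>dihedral_group 3\<^esub> d' = (0, False)" "d' \<otimes>\<^bsub>dihedral_group 3\<^esub> d = (0, False)"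
      using that by (auto simp: d'_def dihedral_group_def)
    ultimately have "g d \<circ> g d' = id" "g d' \<circ> g d = id"
      using g_hom[OF that d'] g_hom[OF d' that] by simp_all
    hence "bij (g d)" by (intro o_bij)
    moreover have "g d x = x" if "x \<notin> {1..3}" for x using that by (auto simp: g_def)
    ultimately show ?thesis by (auto simp: permutes_def bij_iff)
  qed
  hence g_in: "g ` ({0,1,2} \<times> {False, True}) \<subseteq> carrier (sym_group 3)"
    by (auto simp: sym_group_def)
  have g_inj: "inj_on g ({0,1,2} \<times> {False, True})"
  proof (rule inj_onI)
    fix d d' assume d: "d \<in> {0,1,2} \<times> {False, True}" "d' \<in> {0,1,2} \<times> {False, True}" "g d = g d'"
    from d(3) have "g d 1 = g d' 1" "g d 2 = g d' 2" by simp_all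
    thus "d = d'" using d(1,2) by (auto simp: g_def dihedral_act_def)
  qed
  have "card (g ` ({0,1,2} \<times> {False, True})) = card (carrier (sym_group 3))"
    by (subst card_image[OF g_inj]) (simp add: sym_group_card_carrier card_cartesian_product fact_numeral)
  hence "g ` ({0,1,2} \<times> {False, True}) = carrier (sym_group 3)"
    by (intro card_subset_eq g_in) (simp_all add: sym_group_def finite_permutations)
  hence "bij_betw g (carrier (D3_sub False False)) (carrier (sym_group 3))"
    using g_inj unfolding bij_betw_def D3 by blast
  moreover have "g \<in> hom (D3_sub False False) (sym_group 3)"
    by (rule homI) (use g_in g_hom D3 in \<open>auto simp: sym_group_mult\<close>)
  ultimately have "g \<in> iso (D3_sub False False) (sym_group 3)"
    by (simp add: iso_def)
  thus ?thesis by (auto simp: is_iso_def)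
qed

lemma D3_sub_trivial_DirProd_iso: "D3_sub True True \<times>\<times> G \<cong> G"
proof -
  have "snd \<in> iso (D3_sub True True \<times>\<times> G) G"
    by (auto simp: iso_def hom_def D3_sub_carriers(1) bij_betw_def inj_on_def image_iff)
  thus ?thesis by (auto simp: is_iso_def)
qed

text \<open>If the first projection has no common fixed point, it contains a rotation. The
  separating element then allows the second component to be removed. Only closure under products is
  assumed, so inverses are expressed as powers. Everything is phrased in coordinates so that the
  result also applies after swapping the factors.\<close>

lemma D3_square_rotations:
  fixes H :: "((int \<times> bool) \<times> (int \<times> bool)) set"
  assumes H: "H \<subseteq> ({0..<3} \<times> UNIV) \<times> ({0..<3} \<times> UNIV)"
    and mult: "\<And>k s l t k' s' l' t'. ((k, s), (l, t)) \<in> H \<Longrightarrow> ((k', s'), (l', t')) \<in> H \<Longrightarrow>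
      (((if s then k - k' else k + k') mod 3, s \<noteq> s'), ((if t then l - l' else l + l') mod 3, t \<noteq> t')) \<in> H"
    and sep: "\<exists>h\<in>H. snd (fst h) \<noteq> snd (snd h)"
    and move: "\<And>i. i \<in> {0..<3} \<Longrightarrow> \<exists>h\<in>H. dihedral_act (fst h) i mod 3 \<noteq> i"
    and r: "r \<in> {0..<3}"
  shows "((r, False), (0, False)) \<in> H"
proof -
  have carr: "0 \<le> k" "k < 3" "0 \<le> l" "l < 3" if "((k, s), (l, t)) \<in> H" for k s l t
    using that H by auto
  have m: "((k'', s''), (l'', t'')) \<in> H"
    if "((k, s), (l, t)) \<in> H" "((k', s'), (l', t')) \<in> H"
      "k'' = (if s then k - k' else k + k') mod 3" "s'' \<longleftrightarrow> s \<noteq> s'"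
      "l'' = (if t then l - l' else l + l') mod 3" "t'' \<longleftrightarrow> t \<noteq> t'"
    for k k' k'' l l' l'' s s' s'' t t' t''
    using mult[OF that(1,2)] that(3-6) by simp
  \<comment> \<open>An element moving 0 is a nontrivial rotation in the first component, and then it
    serves, or a reflection. A reflection is combined with an element that moves its fixed
    point.\<close>
  have "\<exists>k l t. k \<noteq> 0 \<and> ((k, False), (l, t)) \<in> H"
  proof -
    obtain h where h: "h \<in> H" "dihedral_act (fst h) 0 mod 3 \<noteq> 0" using move[of 0] by auto
    obtain k0 s0 l0 t0 where h_eq: "h = ((k0, s0), (l0, t0))" by (metis surj_pair)
    have h0: "((k0, s0), (l0, t0)) \<in> H" "k0 \<noteq> 0" using h by (auto simp: h_eq dihedral_act_def)
    note c0 = carr[OF h0(1)]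
    show ?thesis
    proof (cases s0)
      case True
      \<comment> \<open>the reflection \<open>x \<mapsto> k0 - x\<close> fixes \<open>2 * k0\<close>\<close>
      define i where "i = (2 * k0) mod 3"
      have "i \<in> {0..<3}" by (simp add: i_def)
      from move[OF this] obtain h' where h': "h' \<in> H" "dihedral_act (fst h') i mod 3 \<noteq> i" by blast
      obtain k1 s1 l1 t1 where h_eq': "h' = ((k1, s1), (l1, t1))" by (metis surj_pair)
      have h1: "((k1, s1), (l1, t1)) \<in> H" "dihedral_act (k1, s1) i mod 3 \<noteq> i"
        using h' by (simp_all add: h_eq')
      note c1 = carr[OF h1(1)]
      show ?thesis
      proof (cases s1)
        case s1: True
        have "(((k0 - k1) mod 3, False), ((if t0 then l0 - l1 else l0 + l1) mod 3, t0 \<noteq> t1)) \<in> H"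
          by (rule m[OF h0(1) h1(1)]) (use True s1 in auto)
        moreover have "(k0 - k1) mod 3 \<noteq> 0"
          using h1(2) s1 int_less_3_cases[OF c0(1,2)] int_less_3_cases[OF c1(1,2)]
          unfolding i_def dihedral_act_def by auto
        ultimately show ?thesis by blast
      next
        case False
        hence "k1 \<noteq> 0" using h1(2) by (auto simp: dihedral_act_def i_def)
        thus ?thesis using h1(1) False by auto
      qed
    qed (use h0 in auto)
  qed
  then obtain k l t where h: "k \<noteq> 0" "((k, False), (l, t)) \<in> H" by blast
  note c = carr[OF h(2)]
  \<comment> \<open>If the second component is a reflection, the fourth power of the element has
    trivial second component and the same first component, as \<open>4 * k\<close> is
    \<open>k\<close> modulo 3.\<close>
  have "\<exists>l. ((k, False), (l, False)) \<in> H"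
  proof (cases t)
    case True
    have x: "(((2 * k) mod 3, False), (0, False)) \<in> H"
      by (rule m[OF h(2) h(2)]) (use True in auto)
    have "k = (2 * k mod 3 + 2 * k mod 3) mod 3" using int_less_3_cases[OF c(1,2)] by auto
    hence "((k, False), (0, False)) \<in> H" by (intro m[OF x x]) simp_all
    thus ?thesis by blast
  qed (use h in auto)
  then obtain l where h: "((k, False), (l, False)) \<in> H" by blast
  note c = carr[OF this]
  have hh: "(((2 * k) mod 3, False), ((2 * l) mod 3, False)) \<in> H"
    by (rule m[OF h h]) auto
  obtain p s q t where g: "((p, s), (q, t)) \<in> H" "s \<noteq> t" using sep by force
  note kc = int_less_3_cases[OF c(1,2)] and lc = int_less_3_cases[OF c(3,4)]
  note pc = int_less_3_cases[OF carr(1,2)[OF g(1)]] and qc = int_less_3_cases[OF carr(3,4)[OF g(1)]]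
  \<comment> \<open>conjugation by the separating element inverts exactly one of the two rotation components\<close>
  have "\<exists>k. k \<noteq> 0 \<and> ((k, False), (0, False)) \<in> H"
  proof (cases s)
    case True
    hence t: "\<not> t" using g by blast
    have gh: "(((p - k) mod 3, True), ((q + l) mod 3, False)) \<in> H"
      by (rule m[OF g(1) h]) (use True t in auto)
    \<comment> \<open>All elements have order dividing 6, so the conjugate of \<open>h\<close> by
      \<open>g\<close> is the product \<open>g h g ^ 5\<close>. It is reached from
      \<open>g h g\<close> by multiplying twice by \<open>g ^ 2\<close>; the result \<open>y\<close>
      is multiplied by \<open>h ^ 2\<close> to cancel the second component.\<close>
    have ghg: "(((- k) mod 3, False), ((2 * q + l) mod 3, False)) \<in> H"
      by (rule m[OF gh g(1)]) (use True t in \<open>auto simp: mod_simps algebra_simps\<close>)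
    have gg: "((0, False), ((2 * q) mod 3, False)) \<in> H"
      by (rule m[OF g(1) g(1)]) (use True t in auto)
    have x: "(((- k) mod 3, False), ((q + l) mod 3, False)) \<in> H"
      by (rule m[OF ghg gg]) (use lc qc in auto)
    have y: "(((- k) mod 3, False), (l, False)) \<in> H"
      by (rule m[OF x gg]) (use lc qc in auto)
    have "((k, False), (0, False)) \<in> H"
      by (rule m[OF hh y]) (use kc lc in auto)
    thus ?thesis using \<open>k \<noteq> 0\<close> by blast
  next
    case False
    hence t: "t" using g by blast
    have gh: "(((p + k) mod 3, False), ((q - l) mod 3, True)) \<in> H"
      by (rule m[OF g(1) h]) (use False t in auto)
    have ghg: "(((2 * p + k) mod 3, False), ((- l) mod 3, False)) \<in> H"
      by (rule m[OF gh g(1)]) (use False t in \<open>auto simp: mod_simps algebra_simps\<close>)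
    have gg: "(((2 * p) mod 3, False), (0, False)) \<in> H"
      by (rule m[OF g(1) g(1)]) (use False t in auto)
    have x: "(((p + k) mod 3, False), ((- l) mod 3, False)) \<in> H"
      by (rule m[OF ghg gg]) (use kc pc in auto)
    have y: "((k, False), ((- l) mod 3, False)) \<in> H"
      by (rule m[OF x gg]) (use kc pc in auto)
    have "(((2 * k) mod 3, False), (0, False)) \<in> H"
      by (rule m[OF h y]) (use kc lc in auto)
    moreover have "(2 * k) mod 3 \<noteq> 0" using \<open>k \<noteq> 0\<close> kc by auto
    ultimately show ?thesis by blast
  qed
  then obtain k where k: "k \<noteq> 0" "((k, False), (0, False)) \<in> H" by blast
  note kc = int_less_3_cases[OF carr(1,2)[OF k(2)]]
  have k2: "(((2 * k) mod 3, False), (0, False)) \<in> H"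
    by (rule m[OF k(2) k(2)]) auto
  have "((0, False), (0, False)) \<in> H"
    by (rule m[OF k2 k(2)]) (use kc in auto)
  moreover have "r = 0 \<or> r = k \<or> r = (2 * k) mod 3" using r k(1) kc int_less_3_cases[of r] by auto
  ultimately show ?thesis using k k2 by blast
qed

text \<open>Once each factor has its pure rotations, or a \<open>T\<close> flag leaves none,
  membership in \<open>H\<close> depends only on the pair of signs. Among the subgroups of pairs of
  signs only the diagonal fails to be a product, and \<open>sep\<close> rules it out.\<close>

lemma D3_square_subset_eq:
  fixes H :: "((int \<times> bool) \<times> (int \<times> bool)) set"
  assumes H: "H \<subseteq> carrier (dihedral_group 3 \<times>\<times> dihedral_group 3)"
    and mult: "\<And>g h. g \<in> H \<Longrightarrow> h \<in> H \<Longrightarrow> g \<otimes>\<^bsub>dihedral_group 3 \<times>\<times> dihedral_group 3\<^esub> h \<in> H"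
    and E1: "E1 \<longleftrightarrow> (\<forall>h\<in>H. \<not> snd (fst h))" and E2: "E2 \<longleftrightarrow> (\<forall>h\<in>H. \<not> snd (snd h))"
    and sep: "\<exists>h\<in>H. snd (fst h) \<noteq> snd (snd h)"
    and T1: "T1 \<Longrightarrow> \<forall>h\<in>H. fst (fst h) = 0" and T2: "T2 \<Longrightarrow> \<forall>h\<in>H. fst (snd h) = 0"
    and move1: "\<And>i. \<not> T1 \<Longrightarrow> i \<in> {0..<3} \<Longrightarrow> \<exists>h\<in>H. dihedral_act (fst h) i mod 3 \<noteq> i"
    and move2: "\<And>i. \<not> T2 \<Longrightarrow> i \<in> {0..<3} \<Longrightarrow> \<exists>h\<in>H. dihedral_act (snd h) i mod 3 \<noteq> i"
  shows "H = D3_subset E1 T1 \<times> D3_subset E2 T2"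
proof -
  have H': "H \<subseteq> ({0..<3} \<times> UNIV) \<times> ({0..<3} \<times> UNIV)"
    using H by (simp add: dihedral_group_def)
  have m: "(((if s then k - k' else k + k') mod 3, s \<noteq> s'), ((if t then l - l' else l + l') mod 3, t \<noteq> t')) \<in> H"
    if "((k, s), (l, t)) \<in> H" "((k', s'), (l', t')) \<in> H" for k k' l l' s s' t t'
    using mult[OF that] by (simp add: dihedral_group_def)
  have rot1: "((r, False), (0, False)) \<in> H" if "\<not> T1" "r \<in> {0..<3}" for r
    by (rule D3_square_rotations[OF H' m sep move1]) (use that in auto)
  have rot2: "((0, False), (r, False)) \<in> H" if "\<not> T2" "r \<in> {0..<3}" for r
  proof -
    have "((r, False), (0, False)) \<in> prod.swap ` H"
    proof (rule D3_square_rotations)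
      show "prod.swap ` H \<subseteq> ({0..<3} \<times> UNIV) \<times> ({0..<3} \<times> UNIV)" using H' by auto
      show "\<exists>h\<in>prod.swap ` H. snd (fst h) \<noteq> snd (snd h)" using sep by force
      show "\<exists>h\<in>prod.swap ` H. dihedral_act (fst h) i mod 3 \<noteq> i" if "i \<in> {0..<3}" for i
        using move2[of i] that \<open>\<not> T2\<close> by force
      show "(((if s then k - k' else k + k') mod 3, s \<noteq> s'), ((if t then l - l' else l + l') mod 3, t \<noteq> t')) \<in> prod.swap ` H"
        if "((k, s), (l, t)) \<in> prod.swap ` H" "((k', s'), (l', t')) \<in> prod.swap ` H" for k k' l l' s s' t t'
        using m[of l t k s l' t' k' s'] that by (simp add: pair_in_swap_image)
    qed (use that in auto)
    thus ?thesis by (simp add: pair_in_swap_image)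
  qed
  \<comment> \<open>The pairs of signs that occur in \<open>H\<close>.\<close>
  define P where "P s t \<longleftrightarrow> (\<exists>k l. ((k, s), (l, t)) \<in> H)" for s t
  have P_mult: "P (s \<noteq> s') (t \<noteq> t')" if "P s t" "P s' t'" for s s' t t'
    using m that unfolding P_def by blast
  obtain p s q t where "((p, s), (q, t)) \<in> H" "s \<noteq> t" using sep by force
  hence sep': "P True False \<or> P False True" by (cases s; cases t) (auto simp: P_def)
  have P_False: "P False False" using sep' P_mult[of True False True False] P_mult[of False True False True] by auto
  have one: "((0, False), (0, False)) \<in> H"
  proof -
    obtain k l where h: "((k, False), (l, False)) \<in> H" using P_False by (auto simp: P_def)
    \<comment> \<open>The identity is obtained as the cube of an element that is a rotation in both
      components.\<close>
    have "(k + (k + k) mod 3) mod 3 = 0" "(l + (l + l) mod 3) mod 3 = 0"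
      by (simp_all add: mod_simps)
    thus ?thesis using m[OF h m[OF h h]] by simp
  qed
  have rot1': "((r, False), (0, False)) \<in> H" if "r \<in> {0..<3}" "T1 \<Longrightarrow> r = 0" for r
    using that rot1 one by metis
  have rot2': "((0, False), (r, False)) \<in> H" if "r \<in> {0..<3}" "T2 \<Longrightarrow> r = 0" for r
    using that rot2 one by metis
  show ?thesis
  proof (intro equalityI subsetI)
    fix h assume h: "h \<in> H"
    have "E1 \<Longrightarrow> \<not> snd (fst h)" "E2 \<Longrightarrow> \<not> snd (snd h)" using E1 E2 h by blast+
    moreover have "T1 \<Longrightarrow> fst (fst h) = 0" "T2 \<Longrightarrow> fst (snd h) = 0" using T1 T2 h by blast+
    ultimately show "h \<in> D3_subset E1 T1 \<times> D3_subset E2 T2"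
      using subsetD[OF H h] by (simp add: D3_subset_def mem_Times_iff)
  next
    fix h assume h: "h \<in> D3_subset E1 T1 \<times> D3_subset E2 T2"
    obtain k s l t where hh: "h = ((k, s), (l, t))" by (metis surj_pair)
    have kl: "k \<in> {0..<3}" "l \<in> {0..<3}" "E1 \<Longrightarrow> \<not> s" "E2 \<Longrightarrow> \<not> t" "T1 \<Longrightarrow> k = 0" "T2 \<Longrightarrow> l = 0"
      using h by (auto simp: hh D3_subset_def dihedral_group_def)
    have E1': "E1 \<longleftrightarrow> \<not> P True True \<and> \<not> P True False"
      unfolding E1 P_def Ball_def split_paired_All all_bool_eq by auto
    have E2': "E2 \<longleftrightarrow> \<not> P True True \<and> \<not> P False True"
      unfolding E2 P_def Ball_def split_paired_All all_bool_eq by auto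
    have "P True True" if "P True False" "P False True" using P_mult[OF that] by simp
    moreover have "P True False" if "P True True" "P False True" using P_mult[OF that] by simp
    moreover have "P False True" if "P True True" "P True False" using P_mult[OF that] by simp
    ultimately have "\<not> E1 \<Longrightarrow> \<not> E2 \<Longrightarrow> P True False \<and> P False True \<and> P True True"
      using E1' E2' sep' by blast
    moreover have "E1 \<Longrightarrow> P False True" "E2 \<Longrightarrow> P True False" using E1' E2' sep' by blast+
    ultimately have "P s t" using kl(3,4) P_False by (cases s; cases t; cases E1; cases E2; simp)
    then obtain k' l' where h': "((k', s), (l', t)) \<in> H" by (auto simp: P_def)
    have k'l': "k' \<in> {0..<3}" "l' \<in> {0..<3}" using H' h' by auto
    \<comment> \<open>The element with the right signs is corrected by pure rotations. Under a
      \<open>T\<close> flag both indices are 0, so the correction is trivial.\<close>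
    have "(((k - k') mod 3, False), (0, False)) \<in> H"
    proof (rule rot1')
      show "(k - k') mod 3 = 0" if T1 using bspec[OF T1[OF that] h'] kl(5)[OF that] by simp
    qed simp
    moreover have "((0, False), ((l - l') mod 3, False)) \<in> H"
    proof (rule rot2')
      show "(l - l') mod 3 = 0" if T2 using bspec[OF T2[OF that] h'] kl(6)[OF that] by simp
    qed simp
    ultimately have "((((k - k') mod 3 + (0 + k') mod 3) mod 3, s), ((0 + ((l - l') mod 3 + l') mod 3) mod 3, t)) \<in> H"
      using m[OF _ m[OF _ h'], of "(k - k') mod 3" False 0 False 0 False "(l - l') mod 3" False] by simp
    thus "h \<in> H" using k'l' kl by (simp add: hh mod_simps)
  qed
qed

lemma order_linear_factor: "order x [:- c, 1:] = of_bool (x = c)"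
proof (cases "x = c")
  case True
  thus ?thesis using order_power_n_n[of c 1] by simp
qed (auto intro: order_0I)

section \<open>The action on the roots of a cubic\<close>

text \<open>The triple is continued periodically to all integers, so that the unreduced values of
  \<open>dihedral_act\<close> can serve as indices.\<close>

definition tri :: "'e \<Rightarrow> 'e \<Rightarrow> 'e \<Rightarrow> int \<Rightarrow> 'e" where
  "tri e0 e1 e2 x = (if x mod 3 = 0 then e0 else if x mod 3 = 1 then e1 else e2)"

lemma tri_simps [simp]: "tri e0 e1 e2 0 = e0" "tri e0 e1 e2 1 = e1" "tri e0 e1 e2 2 = e2"
  by (simp_all add: tri_def)

lemma tri_mod [simp]: "tri e0 e1 e2 (x mod 3) = tri e0 e1 e2 x"
  by (simp add: tri_def)

lemma tri_cases: "tri e0 e1 e2 x \<in> {e0, e1, e2}"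
  by (simp add: tri_def)

lemma tri_eq_iff:
  assumes "e0 \<noteq> e1" "e0 \<noteq> e2" "e1 \<noteq> e2"
  shows "tri e0 e1 e2 x = tri e0 e1 e2 y \<longleftrightarrow> x mod 3 = y mod 3"
proof -
  show ?thesis using int_mod_3_cases[of x] int_mod_3_cases[of y] assms by (elim disjE) (simp_all add: tri_def)
qed

text \<open>All six permutations of the residues modulo 3 have the form
  \<open>x \<mapsto> k0 + x\<close> or \<open>x \<mapsto> k0 - x\<close>. The image of 0 gives
  \<open>k0\<close>, and the image of 1 decides the sign.\<close>

lemma permutation_of_three:
  assumes distinct: "e0 \<noteq> e1" "e0 \<noteq> e2" "e1 \<noteq> e2"
    and inj: "inj_on \<sigma> {e0, e1, e2}" and img: "\<sigma> ` {e0, e1, e2} \<subseteq> {e0, e1, e2}"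
  shows "\<exists>d \<in> carrier (dihedral_group 3). \<forall>x. \<sigma> (tri e0 e1 e2 x) = tri e0 e1 e2 (dihedral_act d x)"
proof -
  let ?e = "tri e0 e1 e2"
  have ex: "\<exists>k\<in>{0..<3}. \<sigma> y = ?e k" if "y \<in> {e0, e1, e2}" for y
  proof -
    have "\<sigma> y \<in> {e0, e1, e2}" using img that by blast
    hence "\<sigma> y = ?e 0 \<or> \<sigma> y = ?e 1 \<or> \<sigma> y = ?e 2" by auto
    moreover have "(0::int) \<in> {0..<3}" "(1::int) \<in> {0..<3}" "(2::int) \<in> {0..<3}" by simp_all
    ultimately show ?thesis by metis
  qed
  obtain k0 where k0: "k0 \<in> {0..<3}" "\<sigma> e0 = ?e k0" using ex[of e0] by blast
  obtain k1 where k1: "k1 \<in> {0..<3}" "\<sigma> e1 = ?e k1" using ex[of e1] by blast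
  obtain k2 where k2: "k2 \<in> {0..<3}" "\<sigma> e2 = ?e k2" using ex[of e2] by blast
  have "\<sigma> e0 \<noteq> \<sigma> e1" "\<sigma> e0 \<noteq> \<sigma> e2" "\<sigma> e1 \<noteq> \<sigma> e2" using inj distinct by (auto simp: inj_on_def)
  hence ne: "k0 \<noteq> k1" "k0 \<noteq> k2" "k1 \<noteq> k2" unfolding k0 k1 k2 by metis+
  have k_cases: "k0 = 0 \<and> k1 = 1 \<and> k2 = 2 \<or> k0 = 0 \<and> k1 = 2 \<and> k2 = 1 \<or> k0 = 1 \<and> k1 = 0 \<and> k2 = 2
    \<or> k0 = 1 \<and> k1 = 2 \<and> k2 = 0 \<or> k0 = 2 \<and> k1 = 0 \<and> k2 = 1 \<or> k0 = 2 \<and> k1 = 1 \<and> k2 = 0"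
    using k0(1) k1(1) k2(1) ne unfolding atLeastLessThan_int_numeral by auto
  define s where "s \<longleftrightarrow> k1 \<noteq> (k0 + 1) mod 3"
  have "\<sigma> (?e x) = ?e (dihedral_act (k0, s) x)" for x
  proof -
    consider "x mod 3 = 0" | "x mod 3 = 1" | "x mod 3 = 2" using int_mod_3_cases[of x] by blast
    thus ?thesis
    proof cases
      case 1
      hence "?e x = e0" "dihedral_act (k0, s) x mod 3 = k0 mod 3"
        using tri_mod[of e0 e1 e2 x] dihedral_act_mod[of "(k0, s)" x] by (simp_all add: dihedral_act_def)
      thus ?thesis using k0 by (metis tri_mod)
    next
      case 2
      hence "?e x = e1" using tri_mod[of e0 e1 e2 x] by simp
      moreover have "dihedral_act (k0, s) x mod 3 = k1 mod 3"
        unfolding dihedral_act_mod[of _ x] 2 using k_cases by (elim disjE) (simp_all add: s_def dihedral_act_def)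
      ultimately show ?thesis using k1 by (metis tri_mod)
    next
      case 3
      hence "?e x = e2" using tri_mod[of e0 e1 e2 x] by simp
      moreover have "dihedral_act (k0, s) x mod 3 = k2 mod 3"
        unfolding dihedral_act_mod[of _ x] 3 using k_cases by (elim disjE) (simp_all add: s_def dihedral_act_def)
      ultimately show ?thesis using k2 by (metis tri_mod)
    qed
  qed
  moreover have "(k0, s) \<in> carrier (dihedral_group 3)" using k0 by (simp add: dihedral_group_def)
  ultimately show ?thesis by blast
qed

text \<open>The value at 0 gives the rotation index; the value at 1 gives the flag, because
  \<open>i + 1\<close> and \<open>i - 1\<close> differ modulo 3.\<close>

lemma dihedral_act_inject:
  assumes "d \<in> carrier (dihedral_group 3)" "d' \<in> carrier (dihedral_group 3)"
    and "\<And>x. dihedral_act d x mod 3 = dihedral_act d' x mod 3"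
  shows "d = d'"
proof -
  have "0 \<le> fst d" "fst d < 3" "0 \<le> fst d'" "fst d' < 3"
    using assms(1,2) by (auto simp: dihedral_group_def)
  moreover have "fst d mod 3 = fst d' mod 3"
    using assms(3)[of 0] by (simp add: dihedral_act_def split: if_splits)
  ultimately have "fst d = fst d'" by simp
  moreover have "snd d = snd d'"
  proof (rule ccontr)
    assume "snd d \<noteq> snd d'"
    hence "(fst d + 1) mod 3 = (fst d - 1) mod 3"
      using assms(3)[of 1] \<open>fst d = fst d'\<close> by (auto simp: dihedral_act_def split: if_splits)
    thus False using int_less_3_cases[of "fst d"] \<open>0 \<le> fst d\<close> \<open>fst d < 3\<close> by auto
  qed
  ultimately show ?thesis by (rule prod_eqI)
qed

text \<open>Instantiated twice below, for \<open>x ^ 3 - b\<close> and for \<open>R\<close>. The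
  numbering of the roots matters: \<open>e0\<close> is the root whose stabilizer is described by the
  \<open>T\<close> flag of \<open>D3_subset\<close>.\<close>

locale cubic_frame =
  fixes f p :: "'a::field poly" and e0 e1 e2 :: "'a alg_closure"
  assumes f: "f \<noteq> 0"
    and p: "map_poly to_ac p = [:- e0, 1:] * [:- e1, 1:] * [:- e2, 1:]"
    and distinct: "e0 \<noteq> e1" "e0 \<noteq> e2" "e1 \<noteq> e2"
    and in_F: "e0 \<in> splitting_field f" "e1 \<in> splitting_field f" "e2 \<in> splitting_field f"
begin

abbreviation "F \<equiv> splitting_field f"
abbreviation "G \<equiv> galois_group closure_ring F base_field"
abbreviation "e \<equiv> tri e0 e1 e2"

lemma e_in_F: "e x \<in> F"
  using tri_cases[of e0 e1 e2 x] in_F by auto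

lemma root_iff: "poly (map_poly to_ac p) x = 0 \<longleftrightarrow> x \<in> {e0, e1, e2}"
  unfolding p poly_mult by auto

lemma separable_p: "separable p"
  unfolding separable_def rsquarefree_def p using distinct
  by (auto simp: order_mult order_linear_factor simp del: mult_pCons_left mult_pCons_right)

lemma label_ex1:
  assumes "\<sigma> \<in> carrier G"
  shows "\<exists>!d. d \<in> carrier (dihedral_group 3) \<and> (\<forall>x. \<sigma> (e x) = e (dihedral_act d x))"
proof -
  note g = galois_groupD[OF assms subfield_splitting_field]
  have "inj_on \<sigma> {e0, e1, e2}"
    by (rule inj_on_subset[OF field_hom_on_inj[OF subfield_splitting_field g(1)]]) (use in_F in auto)
  moreover have "\<sigma> ` {e0, e1, e2} \<subseteq> {e0, e1, e2}"
  proof (rule image_subsetI)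
    fix x assume x: "x \<in> {e0, e1, e2}"
    hence "x \<in> F" using in_F by auto
    moreover have "poly (map_poly to_ac p) x = 0" using x unfolding root_iff .
    ultimately have "poly (map_poly to_ac p) (\<sigma> x) = 0"
      using g(2) by (intro hom_fixing_base_root[OF subfield_splitting_field base_subset_splitting_field g(1)])
    thus "\<sigma> x \<in> {e0, e1, e2}" unfolding root_iff .
  qed
  ultimately have "\<exists>d \<in> carrier (dihedral_group 3). \<forall>x. \<sigma> (e x) = e (dihedral_act d x)"
    by (rule permutation_of_three[OF distinct])
  then obtain d where d: "d \<in> carrier (dihedral_group 3)" "\<forall>x. \<sigma> (e x) = e (dihedral_act d x)" ..
  have "d' = d" if d': "d' \<in> carrier (dihedral_group 3)" "\<forall>x. \<sigma> (e x) = e (dihedral_act d' x)" for d'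
  proof (rule dihedral_act_inject[OF d'(1) d(1)])
    fix x
    have "e (dihedral_act d' x) = e (dihedral_act d x)" using d(2) d'(2) by metis
    thus "dihedral_act d' x mod 3 = dihedral_act d x mod 3" by (simp add: tri_eq_iff[OF distinct])
  qed
  with d show ?thesis by (intro ex1I[of _ d]) simp_all
qed

definition label :: "('a alg_closure \<Rightarrow> 'a alg_closure) \<Rightarrow> int \<times> bool" where
  "label \<sigma> = (THE d. d \<in> carrier (dihedral_group 3) \<and> (\<forall>x. \<sigma> (e x) = e (dihedral_act d x)))"

lemma label:
  assumes "\<sigma> \<in> carrier G"
  shows "label \<sigma> \<in> carrier (dihedral_group 3)" "\<sigma> (e x) = e (dihedral_act (label \<sigma>) x)"
  using theI'[OF label_ex1[OF assms]] unfolding label_def[symmetric] by blast+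

lemma label_mult:
  assumes "\<sigma> \<in> carrier G" "\<tau> \<in> carrier G"
  shows "label (\<sigma> \<otimes>\<^bsub>G\<^esub> \<tau>) = label \<sigma> \<otimes>\<^bsub>dihedral_group 3\<^esub> label \<tau>"
proof -
  interpret GG: group G
    by (rule group_galois_group[OF field_from_type_algebra subfield_splitting_field base_subset_splitting_field])
  interpret D: group "dihedral_group 3" by (rule group_dihedral_group) simp
  have st: "\<sigma> \<otimes>\<^bsub>G\<^esub> \<tau> \<in> carrier G" using assms by simp
  show ?thesis
  proof (rule dihedral_act_inject)
    show "label (\<sigma> \<otimes>\<^bsub>G\<^esub> \<tau>) \<in> carrier (dihedral_group 3)" by (rule label(1)[OF st])
    show "label \<sigma> \<otimes>\<^bsub>dihedral_group 3\<^esub> label \<tau> \<in> carrier (dihedral_group 3)"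
      by (intro D.m_closed label(1) assms)
    fix x
    have "e (dihedral_act (label (\<sigma> \<otimes>\<^bsub>G\<^esub> \<tau>)) x) = (\<sigma> \<otimes>\<^bsub>G\<^esub> \<tau>) (e x)"
      using label(2)[OF st] by simp
    also have "\<dots> = \<sigma> (\<tau> (e x))"
      using e_in_F by (simp add: galois_group_mult[OF assms] compose_def)
    also have "\<dots> = e (dihedral_act (label \<sigma>) (dihedral_act (label \<tau>) x))"
      by (simp add: label(2) assms)
    finally show "dihedral_act (label (\<sigma> \<otimes>\<^bsub>G\<^esub> \<tau>)) x mod 3
        = dihedral_act (label \<sigma> \<otimes>\<^bsub>dihedral_group 3\<^esub> label \<tau>) x mod 3"
      by (simp only: tri_eq_iff[OF distinct] dihedral_act_mult)
  qed
qed

lemma label_act_iff: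
  assumes "\<sigma> \<in> carrier G" "i \<in> {0..<3}"
  shows "dihedral_act (label \<sigma>) i mod 3 = i \<longleftrightarrow> \<sigma> (e i) = e i"
  using assms(2) by (simp add: label(2)[OF assms(1)] tri_eq_iff[OF distinct])

lemma label_fst_eq_0_iff:
  assumes "\<sigma> \<in> carrier G"
  shows "fst (label \<sigma>) = 0 \<longleftrightarrow> \<sigma> e0 = e0"
proof -
  have "dihedral_act (label \<sigma>) 0 mod 3 = fst (label \<sigma>)"
    using label(1)[OF assms] by (auto simp: dihedral_act_def dihedral_group_def)
  thus ?thesis using label_act_iff[OF assms, of 0] by simp
qed

text \<open>The product is a square root of the discriminant, written with cyclic differences. A
  rotation permutes the three differences; a reflection permutes them and negates each one.\<close>

lemma label_discriminant:
  assumes "\<sigma> \<in> carrier G"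
  shows "\<sigma> ((e0 - e1) * (e1 - e2) * (e2 - e0))
    = (if snd (label \<sigma>) then - 1 else 1) * ((e0 - e1) * (e1 - e2) * (e2 - e0))"
proof -
  note g = galois_groupD[OF assms subfield_splitting_field]
  note S = subfield_closed[OF subfield_splitting_field]
  have h: "\<sigma> ((e0 - e1) * (e1 - e2) * (e2 - e0)) = (\<sigma> e0 - \<sigma> e1) * (\<sigma> e1 - \<sigma> e2) * (\<sigma> e2 - \<sigma> e0)"
    by (simp add: field_hom_on_mult[OF subfield_splitting_field g(1)]
        field_hom_on_diff[OF subfield_splitting_field g(1)] in_F S)
  have s: "\<sigma> e0 = e (dihedral_act (label \<sigma>) 0)" "\<sigma> e1 = e (dihedral_act (label \<sigma>) 1)"
    "\<sigma> e2 = e (dihedral_act (label \<sigma>) 2)" using label(2)[OF assms] by (metis tri_simps)+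
  obtain k s where ks: "label \<sigma> = (k, s)" by force
  hence "k = 0 \<or> k = 1 \<or> k = 2" using label(1)[OF assms] by (auto simp: dihedral_group_def)
  thus ?thesis unfolding h s ks
    by (elim disjE; cases s) (simp_all add: dihedral_act_def tri_def algebra_simps)
qed

lemma exists_moving:
  assumes "x \<in> {e0, e1, e2}" "x \<notin> base_field"
  shows "\<exists>\<sigma>\<in>carrier G. \<sigma> x \<noteq> x"
  using splitting_field_fixed[OF f assms(2) separable_p] assms in_F unfolding root_iff by blast

end

lemma two_neq_0:
  assumes "CHAR('a::idom) \<noteq> 2"
  shows "(2 :: 'a) \<noteq> 0"
proof
  assume "(2 :: 'a) = 0"
  hence "CHAR('a) dvd 2" using of_nat_eq_0_iff_char_dvd[of 2, where 'a = 'a] by simp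
  hence "CHAR('a) = 1" using assms two_is_prime_nat by (metis prime_nat_iff)
  thus False by simp
qed

text \<open>In characteristic other than 2 the polynomial \<open>x ^ 2 - u\<close> is separable, so
  \<open>y\<close> is moved by some automorphism, and \<open>- y\<close> is the only other
  root.\<close>

lemma exists_negating:
  fixes f :: "'a::field poly"
  assumes f: "f \<noteq> 0" and char: "CHAR('a) \<noteq> 2"
    and y: "y \<in> splitting_field f" "y\<^sup>2 = to_ac u" "y \<notin> base_field"
  obtains \<sigma> where "\<sigma> \<in> carrier (galois_group closure_ring (splitting_field f) base_field)" "\<sigma> y = - y"
proof -
  have two: "(2 :: 'a alg_closure) \<noteq> 0" by (rule two_neq_0) (use char in simp)
  have "y \<noteq> 0" using y(3) subfield_zero[OF subfield_base_field] by metis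
  hence "y \<noteq> - y" using two by (metis add_eq_0_iff mult_2 mult_eq_0_iff)
  have p: "map_poly to_ac [:- u, 0, 1:] = [:- y, 1:] * [:y, 1:]"
    using y(2) by (simp add: map_poly_pCons power2_eq_square)
  have "separable [:- u, 0, 1:]"
    unfolding separable_def rsquarefree_def p using \<open>y \<noteq> - y\<close> order_linear_factor[of _ "- y"]
    by (auto simp: order_mult order_linear_factor simp del: mult_pCons_left mult_pCons_right)
  moreover have "poly (map_poly to_ac [:- u, 0, 1:]) y = 0" by (simp add: p)
  ultimately obtain \<sigma> where \<sigma>: "\<sigma> \<in> carrier (galois_group closure_ring (splitting_field f) base_field)" "\<sigma> y \<noteq> y"
    using splitting_field_fixed[OF f y(3) _ _ y(1)] by blast
  note g = galois_groupD[OF \<sigma>(1) subfield_splitting_field]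
  have "(\<sigma> y)\<^sup>2 = y\<^sup>2"
    using field_hom_on_power[OF subfield_splitting_field g(1) y(1), of 2] g(2)[of "to_ac u"] y(2) by simp
  hence "\<sigma> y = - y" using \<sigma>(2) by (simp add: power2_eq_iff)
  thus ?thesis using that \<sigma>(1) by blast
qed

section \<open>The sextic\<close>

lemma irreducible_field_poly_factor:
  fixes p q r :: "'a::field poly"
  assumes "Factorial_Ring.irreducible p" "p = q * r"
  shows "degree q = 0 \<or> degree r = 0"
  using Factorial_Ring.irreducibleD[OF assms] by (auto elim!: is_unit_polyE)

lemma irreducible_cubic_iff:
  fixes p :: "'a::field poly"
  assumes deg: "degree p = 3"
  shows "Factorial_Ring.irreducible p \<longleftrightarrow> (\<forall>x. poly p x \<noteq> 0)"
proof
  assume irr: "Factorial_Ring.irreducible p"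
  show "\<forall>x. poly p x \<noteq> 0"
  proof (intro allI notI)
    fix x assume "poly p x = 0"
    then obtain q where q: "p = [:- x, 1:] * q" using poly_eq_0_iff_dvd by (metis dvdE)
    hence "degree q = 2" using deg by (cases "q = 0") (simp_all add: degree_mult_eq del: mult_pCons_left)
    with irreducible_field_poly_factor[OF irr q] show False by simp
  qed
next
  assume noroot: "\<forall>x. poly p x \<noteq> 0"
  have lin: False if "degree q = 1" "p = q * r" for q r
  proof -
    obtain u v where q: "q = [:u, v:]" "v \<noteq> 0" using \<open>degree q = 1\<close> by (metis degree1_coeffs One_nat_def)
    have "poly p (- u / v) = 0" using q that(2) by simp
    thus False using noroot by blast
  qed
  show "Factorial_Ring.irreducible p"
  proof (rule Factorial_Ring.irreducibleI)
    show "p \<noteq> 0" using deg by auto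
    thus "\<not> p dvd 1" using deg by (simp add: is_unit_iff_degree)
    fix q r assume qr: "p = q * r"
    hence "q \<noteq> 0" "r \<noteq> 0" using deg by auto
    hence "degree q + degree r = 3" using deg qr by (simp add: degree_mult_eq)
    moreover have "degree q \<noteq> 1" using lin[of q r] qr by blast
    moreover have "degree r \<noteq> 1" using lin[of r q] qr by (metis mult.commute)
    ultimately have "degree q = 0 \<or> degree r = 0" by linarith
    thus "q dvd 1 \<or> r dvd 1" using \<open>q \<noteq> 0\<close> \<open>r \<noteq> 0\<close> by (simp add: is_unit_iff_degree)
  qed
qed

text \<open>The quadratic in \<open>x ^ 3\<close> splits by the quadratic formula. Irreducibility of
  the sextic therefore makes \<open>a\<^sup>2 - 4 * b\<close> a non-square.\<close>

lemma sextic_factors_over_square_root: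
  fixes a b d :: "'a::field"
  assumes "(2::'a) \<noteq> 0" "a\<^sup>2 - 4 * b = d\<^sup>2"
  shows "[:b, 0, 0, a, 0, 0, 1:] = [:(a - d) / 2, 0, 0, 1:] * [:(a + d) / 2, 0, 0, 1:]"
proof -
  have "b * (2 * 2) = (a - d) * (a + d)" using assms(2) by Groebner_Basis.algebra
  moreover have "(2::'a) * 2 \<noteq> 0" using assms(1) by (metis mult_eq_0_iff)
  ultimately have "b = (a - d) / 2 * ((a + d) / 2)"
    unfolding times_divide_times_eq by (metis eq_divide_imp)
  moreover have "(a - d) / 2 + (a + d) / 2 = a" using assms(1) by (simp add: field_simps)
  ultimately show ?thesis by (simp add: algebra_simps)
qed

text \<open>For \<open>c = \<alpha> * \<beta>\<close> and \<open>m = \<alpha> + \<beta>\<close> the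
  middle coefficient is \<open>- (\<alpha> ^ 3 + \<beta> ^ 3)\<close>, the quadratic has the roots
  \<open>\<alpha>\<close> and \<open>\<beta>\<close>, and the quartic is \<open>(x\<^sup>2 +
  \<alpha> x + \<alpha>\<^sup>2) (x\<^sup>2 + \<beta> x + \<beta>\<^sup>2)\<close>.\<close>

lemma sextic_factors_over_quadratic:
  fixes c m :: "'a::comm_ring_1"
  shows "[:c ^ 3, 0, 0, 3 * c * m - m ^ 3, 0, 0, 1:] = [:c, - m, 1:] * [:c\<^sup>2, m * c, m\<^sup>2 - c, m, 1:]"
  by (simp add: algebra_simps power2_eq_square power3_eq_cube)

lemma cubic_expand:
  fixes x y z :: "'a::comm_ring_1"
  shows "[:- x, 1:] * [:- y, 1:] * [:- z, 1:] = [:- (x * y * z), x * y + x * z + y * z, - (x + y + z), 1:]"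
  by (simp add: algebra_simps)

lemma to_ac_in_base: "to_ac x \<in> base_field"
  by blast

lemma irreducible_sextic_constant:
  fixes a b :: "'a::field"
  assumes "Factorial_Ring.irreducible [:b, 0, 0, a, 0, 0, 1:]"
  shows "b \<noteq> 0"
proof
  assume "b = 0"
  hence "[:b, 0, 0, a, 0, 0, 1:] = [:0, 1:] * [:0, 0, a, 0, 0, 1:]" by simp
  from irreducible_field_poly_factor[OF assms this] show False by simp
qed

text \<open>The equation \<open>\<alpha> * \<beta> = c\<close> couples the choices of cube roots:
  the cubes of \<open>\<alpha>\<close> and \<open>\<beta>\<close> fix their product only up to a
  cube root of unity. Which cube root of \<open>b\<close> is \<open>c\<close> stays open here; it is
  normalized in \<open>galois_group_iso\<close>.\<close>

locale sextic =
  fixes a b :: "'a::field" and \<zeta> c \<alpha> \<beta> :: "'a alg_closure"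
  assumes char: "CHAR('a) \<noteq> 2"
    and irr: "Factorial_Ring.irreducible [:b, 0, 0, a, 0, 0, 1:]"
    and \<zeta>: "primitive_root_of_unity 3 \<zeta>"
    and \<alpha>\<beta>: "\<alpha> * \<beta> = c" and c3: "c ^ 3 = to_ac b" and sum_cubes: "\<alpha> ^ 3 + \<beta> ^ 3 = - to_ac a"
begin

abbreviation "f \<equiv> [:b, 0, 0, a, 0, 0, 1:]"
abbreviation "R \<equiv> [:a * b, - 3 * b, 0, 1:]"
abbreviation "F \<equiv> splitting_field f"
abbreviation "G \<equiv> galois_group closure_ring F base_field"

lemma two_neq_0: "(2 :: 'a) \<noteq> 0" "(2 :: 'a alg_closure) \<noteq> 0"
  using char by (intro two_neq_0; simp)+

lemma zeta3: "\<zeta> ^ 3 = 1" and zeta_neq_1: "\<zeta> \<noteq> 1"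
  using \<zeta> by (auto simp: primitive_root_of_unity_def dest: spec[of _ 1])

lemma zeta_quadratic: "\<zeta>\<^sup>2 + \<zeta> + 1 = 0"
proof -
  have "(\<zeta> - 1) * (\<zeta>\<^sup>2 + \<zeta> + 1) = 0" using zeta3 by Groebner_Basis.algebra
  thus ?thesis using zeta_neq_1 by simp
qed

text \<open>In characteristic 3 one has
  \<open>(\<zeta> - 1)\<^sup>2 = \<zeta>\<^sup>2 + \<zeta> + 1\<close>, which is 0; so the existence
  of \<open>\<zeta>\<close> excludes this characteristic.\<close>

lemma three_neq_0: "(3 :: 'a alg_closure) \<noteq> 0"
proof
  assume "(3 :: 'a alg_closure) = 0"
  moreover have "(\<zeta> - 1)\<^sup>2 = \<zeta>\<^sup>2 + \<zeta> + 1 - 3 * \<zeta>" by Groebner_Basis.algebra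
  ultimately have "(\<zeta> - 1)\<^sup>2 = 0" using zeta_quadratic by simp
  thus False using zeta_neq_1 by simp
qed

lemma zeta_distinct: "\<zeta> \<noteq> 0" "\<zeta>\<^sup>2 \<noteq> 1" "\<zeta>\<^sup>2 \<noteq> \<zeta>"
proof -
  show "\<zeta> \<noteq> 0" using zeta3 by auto
  thus "\<zeta>\<^sup>2 \<noteq> \<zeta>" using zeta_neq_1 by (simp add: power2_eq_square)
  show "\<zeta>\<^sup>2 \<noteq> 1" using zeta3 zeta_neq_1 by (auto simp: power2_eq_square power3_eq_cube)
qed

lemma b_neq_0: "b \<noteq> 0"
  using irr by (rule irreducible_sextic_constant)

lemma c_neq_0: "c \<noteq> 0" and \<alpha>_neq_0: "\<alpha> \<noteq> 0" and \<beta>_neq_0: "\<beta> \<noteq> 0"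
proof -
  show "c \<noteq> 0" using b_neq_0 c3 by auto
  thus "\<alpha> \<noteq> 0" "\<beta> \<noteq> 0" using \<alpha>\<beta> by auto
qed

lemma prod_cubes: "\<alpha> ^ 3 * \<beta> ^ 3 = to_ac b"
  using c3 \<alpha>\<beta> by (metis power_mult_distrib)

lemma discriminant_not_square: "\<not> is_square (a\<^sup>2 - 4 * b)"
proof
  assume "is_square (a\<^sup>2 - 4 * b)"
  then obtain d where d: "a\<^sup>2 - 4 * b = d\<^sup>2" by (auto elim: is_nth_powerE)
  from irreducible_field_poly_factor[OF irr sextic_factors_over_square_root[OF two_neq_0(1) d]]
  show False by simp
qed

lemma sq_diff_cubes: "(\<alpha> ^ 3 - \<beta> ^ 3)\<^sup>2 = to_ac (a\<^sup>2 - 4 * b)"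
proof -
  have "(\<alpha> ^ 3 - \<beta> ^ 3)\<^sup>2 = (\<alpha> ^ 3 + \<beta> ^ 3)\<^sup>2 - 4 * (\<alpha> ^ 3 * \<beta> ^ 3)" by Groebner_Basis.algebra
  thus ?thesis unfolding sum_cubes prod_cubes by simp
qed

lemma diff_cubes_notin_base: "\<alpha> ^ 3 - \<beta> ^ 3 \<notin> base_field"
proof
  assume "\<alpha> ^ 3 - \<beta> ^ 3 \<in> base_field"
  then obtain d where "\<alpha> ^ 3 - \<beta> ^ 3 = to_ac d" by blast
  hence "to_ac (d\<^sup>2) = to_ac (a\<^sup>2 - 4 * b)" using sq_diff_cubes by simp
  hence "a\<^sup>2 - 4 * b = d\<^sup>2" by (simp only: to_ac_eq_iff)
  thus False using discriminant_not_square by simp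
qed

lemma poly_f: "poly (map_poly to_ac f) x = (x ^ 3 - \<alpha> ^ 3) * (x ^ 3 - \<beta> ^ 3)"
proof -
  have "poly (map_poly to_ac f) x = x ^ 6 + to_ac a * x ^ 3 + to_ac b"
    by (simp add: map_poly_pCons algebra_simps power_numeral_reduce)
  moreover have "to_ac a = - (\<alpha> ^ 3 + \<beta> ^ 3)" using sum_cubes by simp
  ultimately show ?thesis unfolding prod_cubes[symmetric] by Groebner_Basis.algebra
qed

lemma roots_in_F: "\<alpha> \<in> F" "\<beta> \<in> F" "\<zeta> \<in> F" "c \<in> F"
proof -
  show A: "\<alpha> \<in> F" "\<beta> \<in> F" by (simp_all add: root_in_splitting_field poly_f)
  have "\<zeta> * \<alpha> \<in> F" by (simp add: root_in_splitting_field poly_f power_mult_distrib zeta3)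
  hence "(\<zeta> * \<alpha>) / \<alpha> \<in> F" by (rule subfield_divide[OF subfield_splitting_field _ A(1)])
  thus "\<zeta> \<in> F" using \<alpha>_neq_0 by simp
  show "c \<in> F" unfolding \<alpha>\<beta>[symmetric] using A by (rule subfield_mult[OF subfield_splitting_field])
qed

lemmas in_F = roots_in_F subfield_closed[OF subfield_splitting_field]

lemma cube_eq_iff: "x ^ 3 = y ^ 3 \<longleftrightarrow> x \<in> {y, \<zeta> * y, \<zeta>\<^sup>2 * y}" for x y :: "'a alg_closure"
proof -
  have "x ^ 3 - y ^ 3 = (x - y) * (x - \<zeta> * y) * (x - \<zeta>\<^sup>2 * y)"
    using zeta_quadratic by Groebner_Basis.algebra
  thus ?thesis by (metis (no_types, lifting) eq_iff_diff_eq_0 insert_iff mult_eq_0_iff singletonD)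
qed

lemma splitting_field_subset:
  assumes M: "subfield M closure_ring" "base_field \<subseteq> M" "\<alpha> \<in> M" "\<beta> \<in> M" "\<zeta> \<in> M"
  shows "F \<subseteq> M"
proof (rule splitting_field_minimal[OF M(1,2)])
  fix x assume "poly (map_poly to_ac f) x = 0"
  hence "x ^ 3 = \<alpha> ^ 3 \<or> x ^ 3 = \<beta> ^ 3" by (simp add: poly_f)
  thus "x \<in> M" unfolding cube_eq_iff using M by (auto intro: subfield_closed[OF M(1)])
qed

lemma alpha_neq_zeta_beta: "\<alpha> \<noteq> \<beta>" "\<alpha> \<noteq> \<zeta> * \<beta>" "\<alpha> \<noteq> \<zeta>\<^sup>2 * \<beta>"
proof -
  have "\<alpha> ^ 3 \<noteq> \<beta> ^ 3" using diff_cubes_notin_base subfield_zero[OF subfield_base_field] by auto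
  thus "\<alpha> \<noteq> \<beta>" "\<alpha> \<noteq> \<zeta> * \<beta>" "\<alpha> \<noteq> \<zeta>\<^sup>2 * \<beta>" unfolding cube_eq_iff by auto
qed

sublocale C: cubic_frame f "[:- b, 0, 0, 1:]" c "\<zeta> * c" "\<zeta>\<^sup>2 * c"
proof
  have "c * (\<zeta> * c) * (\<zeta>\<^sup>2 * c) = c ^ 3" using zeta_quadratic by Groebner_Basis.algebra
  moreover have "c * (\<zeta> * c) + c * (\<zeta>\<^sup>2 * c) + \<zeta> * c * (\<zeta>\<^sup>2 * c) = 0"
    using zeta_quadratic by Groebner_Basis.algebra
  moreover have "c + \<zeta> * c + \<zeta>\<^sup>2 * c = 0" using zeta_quadratic by Groebner_Basis.algebra
  ultimately show "map_poly to_ac [:- b, 0, 0, 1:] = [:- c, 1:] * [:- (\<zeta> * c), 1:] * [:- (\<zeta>\<^sup>2 * c), 1:]"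
    unfolding cubic_expand by (simp add: map_poly_pCons c3)
qed (use c_neq_0 zeta_neq_1 zeta_distinct in \<open>auto intro: in_F\<close>)

definition "t0 = \<alpha>\<^sup>2 * \<beta> + \<alpha> * \<beta>\<^sup>2"
definition "t1 = \<zeta> * (\<alpha>\<^sup>2 * \<beta>) + \<zeta>\<^sup>2 * (\<alpha> * \<beta>\<^sup>2)"
definition "t2 = \<zeta>\<^sup>2 * (\<alpha>\<^sup>2 * \<beta>) + \<zeta> * (\<alpha> * \<beta>\<^sup>2)"

text \<open>Serves both the distinctness of the roots of \<open>R\<close> and the discriminant: the
  last factors multiply to \<open>\<alpha> ^ 3 - \<beta> ^ 3\<close>.\<close>

lemma t_diff: "t0 - t1 = c * (1 - \<zeta>) * (\<alpha> - \<zeta>\<^sup>2 * \<beta>)" "t1 - t2 = c * (\<zeta> - \<zeta>\<^sup>2) * (\<alpha> - \<beta>)"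
  "t2 - t0 = c * (\<zeta>\<^sup>2 - 1) * (\<alpha> - \<zeta> * \<beta>)"
proof -
  note defs = t0_def t1_def t2_def \<alpha>\<beta>[symmetric]
  show "t0 - t1 = c * (1 - \<zeta>) * (\<alpha> - \<zeta>\<^sup>2 * \<beta>)"
    unfolding defs using zeta_quadratic by Groebner_Basis.algebra
  show "t1 - t2 = c * (\<zeta> - \<zeta>\<^sup>2) * (\<alpha> - \<beta>)"
    unfolding defs by Groebner_Basis.algebra
  show "t2 - t0 = c * (\<zeta>\<^sup>2 - 1) * (\<alpha> - \<zeta> * \<beta>)"
    unfolding defs using zeta_quadratic by Groebner_Basis.algebra
qed

sublocale T: cubic_frame f R t0 t1 t2
proof
  have s: "t0 + t1 + t2 = 0" unfolding t0_def t1_def t2_def using zeta_quadratic by Groebner_Basis.algebra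
  have "t0 * t1 + t0 * t2 + t1 * t2 = - 3 * c ^ 3"
    unfolding t0_def t1_def t2_def \<alpha>\<beta>[symmetric] using zeta_quadratic by Groebner_Basis.algebra
  moreover have "t0 * t1 * t2 = c ^ 3 * (\<alpha> ^ 3 + \<beta> ^ 3)"
    unfolding t0_def t1_def t2_def \<alpha>\<beta>[symmetric] using zeta_quadratic by Groebner_Basis.algebra
  ultimately show "map_poly to_ac R = [:- t0, 1:] * [:- t1, 1:] * [:- t2, 1:]"
    unfolding cubic_expand s by (simp add: map_poly_pCons c3 sum_cubes)
  show "t0 \<noteq> t1" "t1 \<noteq> t2" "t0 \<noteq> t2"
    using t_diff c_neq_0 zeta_neq_1 zeta_distinct alpha_neq_zeta_beta by (metis mult_eq_0_iff right_minus_eq)+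
qed (auto simp: t0_def t1_def t2_def intro!: in_F)

lemma disc_C: "(c - \<zeta> * c) * (\<zeta> * c - \<zeta>\<^sup>2 * c) * (\<zeta>\<^sup>2 * c - c) = to_ac (- 3 * b) * (\<zeta> - \<zeta>\<^sup>2)"
proof -
  have "(c - \<zeta> * c) * (\<zeta> * c - \<zeta>\<^sup>2 * c) * (\<zeta>\<^sup>2 * c - c) = - 3 * c ^ 3 * (\<zeta> - \<zeta>\<^sup>2)"
    using zeta_quadratic by Groebner_Basis.algebra
  thus ?thesis by (simp add: c3)
qed

text \<open>Compared with \<open>disc_C\<close> there is exactly one extra factor, a square root of
  \<open>a\<^sup>2 - 4 * b\<close>. This is why the two sign characters cannot coincide.\<close>

lemma disc_T: "(t0 - t1) * (t1 - t2) * (t2 - t0) = to_ac (- 3 * b) * ((\<zeta> - \<zeta>\<^sup>2) * (\<alpha> ^ 3 - \<beta> ^ 3))"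
proof -
  have "(t0 - t1) * (t1 - t2) * (t2 - t0) = - 3 * c ^ 3 * ((\<zeta> - \<zeta>\<^sup>2) * (\<alpha> ^ 3 - \<beta> ^ 3))"
    unfolding t_diff using zeta_quadratic by Groebner_Basis.algebra
  thus ?thesis by (simp add: c3)
qed


section \<open>Sign characters and square classes\<close>

lemma galois_group_group: "group G"
  by (rule group_galois_group[OF field_from_type_algebra subfield_splitting_field base_subset_splitting_field])

text \<open>Translates a square condition in \<open>K\<close> into a condition on signs;
  \<open>P\<close> will be the flag of a label and \<open>y\<close> a square root of a
  discriminant.\<close>

lemma square_base_iff:
  assumes y: "y \<in> F" "y\<^sup>2 = to_ac u" and \<sigma>: "\<And>\<sigma>. \<sigma> \<in> carrier G \<Longrightarrow> \<sigma> y = (if P \<sigma> then - 1 else 1) * y"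
    and y0: "y \<noteq> 0"
  shows "y \<in> base_field \<longleftrightarrow> (\<forall>\<sigma>\<in>carrier G. \<not> P \<sigma>)"
proof -
  have "y \<noteq> - y" using y0 two_neq_0(2) by (metis add_eq_0_iff mult_2 mult_eq_0_iff)
  show ?thesis
  proof
    assume yK: "y \<in> base_field"
    show "\<forall>\<sigma>\<in>carrier G. \<not> P \<sigma>"
    proof
      fix \<sigma> assume g: "\<sigma> \<in> carrier G"
      have "\<sigma> y = y" by (rule galois_groupD(2)[OF g subfield_splitting_field yK])
      thus "\<not> P \<sigma>" using \<sigma>[OF g] \<open>y \<noteq> - y\<close> by (auto split: if_splits)
    qed
  next
    assume noP: "\<forall>\<sigma>\<in>carrier G. \<not> P \<sigma>"
    show "y \<in> base_field"
    proof (rule ccontr)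
      assume "y \<notin> base_field"
      then obtain \<sigma> where "\<sigma> \<in> carrier G" "\<sigma> y = - y"
        using exists_negating[OF C.f char y] by blast
      thus False using \<sigma>[of \<sigma>] noP \<open>y \<noteq> - y\<close> by auto
    qed
  qed
qed

text \<open>A square root of \<open>-3\<close>, related to \<open>\<zeta>\<close> by
  \<open>\<zeta> = (w - 1) / 2\<close>.\<close>

definition "w = \<zeta> - \<zeta>\<^sup>2"

lemma w_sq: "w\<^sup>2 = to_ac (- 3)"
proof -
  have "w\<^sup>2 = - 3" unfolding w_def using zeta_quadratic by Groebner_Basis.algebra
  thus ?thesis by simp
qed

lemma w_neq_0: "w \<noteq> 0"
  using w_sq three_neq_0 by auto

lemma w_in_base_iff: "w \<in> base_field \<longleftrightarrow> \<zeta> \<in> base_field"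
proof
  assume "w \<in> base_field"
  then obtain v where "w = to_ac v" by blast
  moreover have "\<zeta> = (w - 1) / 2"
  proof -
    have "\<zeta> * 2 = w - 1" unfolding w_def using zeta_quadratic by Groebner_Basis.algebra
    thus ?thesis using two_neq_0(2) by (rule eq_divide_imp[rotated])
  qed
  ultimately have "\<zeta> = to_ac ((v - 1) / 2)" by simp
  thus "\<zeta> \<in> base_field" by blast
next
  assume "\<zeta> \<in> base_field"
  thus "w \<in> base_field" unfolding w_def by (intro subfield_closed[OF subfield_base_field])
qed

text \<open>A square root of \<open>a\<^sup>2 - 4 * b\<close>, lying outside
  \<open>K\<close>.\<close>

definition "d = \<alpha> ^ 3 - \<beta> ^ 3"

lemma d_neq_0: "d \<noteq> 0"
  unfolding d_def using diff_cubes_notin_base subfield_zero[OF subfield_base_field] by metis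

lemma wd_sq: "(w * d)\<^sup>2 = to_ac (- 3 * (a\<^sup>2 - 4 * b))"
  unfolding power_mult_distrib w_sq d_def sq_diff_cubes by simp

lemma wd_in_base_iff: "w * d \<in> base_field \<longleftrightarrow> is_square (- 3 * (a\<^sup>2 - 4 * b))"
proof
  assume "w * d \<in> base_field"
  then obtain v where "w * d = to_ac v" by blast
  hence "to_ac (v\<^sup>2) = to_ac (- 3 * (a\<^sup>2 - 4 * b))" using wd_sq by simp
  hence "- 3 * (a\<^sup>2 - 4 * b) = v\<^sup>2" by (simp only: to_ac_eq_iff)
  thus "is_square (- 3 * (a\<^sup>2 - 4 * b))" by simp
next
  assume "is_square (- 3 * (a\<^sup>2 - 4 * b))"
  then obtain v where "- 3 * (a\<^sup>2 - 4 * b) = v\<^sup>2" by (auto elim: is_nth_powerE)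
  hence "(w * d)\<^sup>2 = (to_ac v)\<^sup>2" using wd_sq by simp
  hence "w * d = to_ac v \<or> w * d = to_ac (- v)" unfolding power2_eq_iff by simp
  thus "w * d \<in> base_field" by blast
qed

lemma scale_base_iff: "to_ac (- 3 * b) * y \<in> base_field \<longleftrightarrow> y \<in> base_field"
proof -
  have ne: "to_ac (- 3 * b) \<noteq> 0" using three_neq_0 b_neq_0 by simp
  show ?thesis
  proof
    assume "to_ac (- 3 * b) * y \<in> base_field"
    hence "to_ac (- 3 * b) * y / to_ac (- 3 * b) \<in> base_field"
      by (intro subfield_divide[OF subfield_base_field] to_ac_in_base)
    thus "y \<in> base_field" using ne by simp
  qed (intro subfield_mult[OF subfield_base_field] to_ac_in_base)
qed

text \<open>\<open>D1\<close> and \<open>D2\<close> are square roots of the discriminants of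
  \<open>x ^ 3 - b\<close> and of \<open>R\<close>. The factor \<open>-3 * b\<close> is a nonzero
  element of \<open>K\<close> and does not affect membership in \<open>K\<close>.\<close>

definition "D1 = to_ac (- 3 * b) * w"
definition "D2 = to_ac (- 3 * b) * (w * d)"

lemma D1: "\<sigma> \<in> carrier G \<Longrightarrow> \<sigma> D1 = (if snd (C.label \<sigma>) then - 1 else 1) * D1"
  using C.label_discriminant[of \<sigma>] unfolding disc_C D1_def w_def .

lemma D2: "\<sigma> \<in> carrier G \<Longrightarrow> \<sigma> D2 = (if snd (T.label \<sigma>) then - 1 else 1) * D2"
  using T.label_discriminant[of \<sigma>] unfolding disc_T D2_def w_def d_def .

lemma w_d_in_F: "w \<in> F" "d \<in> F" "to_ac x \<in> F"
  using base_subset_splitting_field[of f] by (auto simp: w_def d_def intro!: in_F)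

lemma D_neq_0: "D1 \<noteq> 0" "D2 \<noteq> 0"
  unfolding D1_def D2_def using three_neq_0 b_neq_0 w_neq_0 d_neq_0 by simp_all

lemma zeta_base_iff: "\<zeta> \<in> base_field \<longleftrightarrow> (\<forall>\<sigma>\<in>carrier G. \<not> snd (C.label \<sigma>))"
proof -
  have "D1\<^sup>2 = to_ac ((- 3 * b)\<^sup>2 * - 3)" unfolding D1_def power_mult_distrib w_sq by simp
  moreover have "D1 \<in> F" unfolding D1_def by (intro in_F w_d_in_F)
  ultimately show ?thesis using square_base_iff[where P = "\<lambda>\<sigma>. snd (C.label \<sigma>)", OF _ _ D1 D_neq_0(1)]
    unfolding D1_def scale_base_iff w_in_base_iff by blast
qed

lemma square_iff: "is_square (- 3 * (a\<^sup>2 - 4 * b)) \<longleftrightarrow> (\<forall>\<sigma>\<in>carrier G. \<not> snd (T.label \<sigma>))"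
proof -
  have "D2\<^sup>2 = to_ac ((- 3 * b)\<^sup>2 * (- 3 * (a\<^sup>2 - 4 * b)))"
    unfolding D2_def power_mult_distrib[of "to_ac (- 3 * b)"] wd_sq by simp
  moreover have "D2 \<in> F" unfolding D2_def by (intro in_F w_d_in_F)
  ultimately show ?thesis using square_base_iff[where P = "\<lambda>\<sigma>. snd (T.label \<sigma>)", OF _ _ D2 D_neq_0(2)]
    unfolding D2_def scale_base_iff wd_in_base_iff by blast
qed

text \<open>Since \<open>D2 = D1 * d\<close>, an automorphism that negates \<open>d\<close> has
  opposite signs on \<open>D1\<close> and \<open>D2\<close>.\<close>

lemma exists_separating: "\<exists>\<sigma>\<in>carrier G. snd (C.label \<sigma>) \<noteq> snd (T.label \<sigma>)"
proof -
  obtain \<sigma> where \<sigma>: "\<sigma> \<in> carrier G" "\<sigma> d = - d"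
    using exists_negating[OF C.f char] w_d_in_F(2) sq_diff_cubes diff_cubes_notin_base
    unfolding d_def by metis
  have D2': "D2 = D1 * d" by (simp add: D1_def D2_def)
  have "\<sigma> D2 = \<sigma> D1 * \<sigma> d"
    unfolding D2' D1_def
    by (rule field_hom_on_mult[OF subfield_splitting_field
          galois_groupD(1)[OF \<sigma>(1) subfield_splitting_field]]) (intro in_F w_d_in_F)+
  hence "\<sigma> D2 = - (if snd (C.label \<sigma>) then - 1 else 1) * D2"
    unfolding \<sigma>(2) D1[OF \<sigma>(1)] D2' by simp
  moreover have "D2 \<noteq> - D2" using D_neq_0(2) two_neq_0(2) by (metis add_eq_0_iff mult_2 mult_eq_0_iff)
  ultimately have "snd (C.label \<sigma>) \<noteq> snd (T.label \<sigma>)" using D2[OF \<sigma>(1)] by (auto split: if_splits)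
  thus ?thesis using \<sigma>(1) by blast
qed

text \<open>The elements on which the two automorphisms agree form a subfield. It contains the roots
  of both cubics, and \<open>\<zeta>\<close>, \<open>\<alpha>\<close> and \<open>\<beta>\<close> can
  be computed rationally from these.\<close>

lemma labels_inj:
  assumes \<sigma>: "\<sigma> \<in> carrier G" and \<tau>: "\<tau> \<in> carrier G"
    and eq: "C.label \<sigma> = C.label \<tau>" "T.label \<sigma> = T.label \<tau>"
  shows "\<sigma> = \<tau>"
proof (rule galois_group_eqI[OF \<sigma> \<tau>])
  note S = subfield_splitting_field
  note hs = galois_groupD[OF \<sigma> S] and ht = galois_groupD[OF \<tau> S]
  define M where "M = {x \<in> F. \<sigma> x = \<tau> x}"
  have M: "subfield M closure_ring"
    unfolding subfield_type_algebra_iff M_def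
    by (intro conjI ballI CollectI)
      (simp_all add: in_F field_hom_on_1[OF S hs(1)] field_hom_on_1[OF S ht(1)]
        field_hom_on_uminus[OF S hs(1)] field_hom_on_uminus[OF S ht(1)]
        field_hom_on_inverse[OF S hs(1)] field_hom_on_inverse[OF S ht(1)]
        field_hom_on_add[OF S hs(1)] field_hom_on_add[OF S ht(1)]
        field_hom_on_mult[OF S hs(1)] field_hom_on_mult[OF S ht(1)])
  note MM = subfield_closed[OF M]
  have KM: "base_field \<subseteq> M"
    unfolding M_def using base_subset_splitting_field[of f] hs(2) ht(2) by auto
  have e: "C.e x \<in> M" "T.e x \<in> M" for x
    unfolding M_def using C.label(2)[OF \<sigma>] C.label(2)[OF \<tau>] T.label(2)[OF \<sigma>] T.label(2)[OF \<tau>] eq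
    by (simp_all add: C.e_in_F T.e_in_F)
  have cM: "c \<in> M" "\<zeta> * c \<in> M" "t0 \<in> M" "t1 \<in> M"
    using e(1)[of 0] e(1)[of 1] e(2)[of 0] e(2)[of 1] by simp_all
  have "\<zeta> = (\<zeta> * c) / c" using c_neq_0 by simp
  hence zM: "\<zeta> \<in> M" using subfield_divide[OF M cM(2,1)] by simp
  \<comment> \<open>This combination eliminates \<open>\<alpha> * \<beta>\<^sup>2\<close>; dividing
    by \<open>w * c\<close> then leaves \<open>\<alpha>\<close>.\<close>
  have "t1 - \<zeta>\<^sup>2 * t0 = w * (\<alpha>\<^sup>2 * \<beta>)" unfolding t0_def t1_def w_def by Groebner_Basis.algebra
  hence "w * (\<alpha>\<^sup>2 * \<beta>) \<in> M" using MM cM zM by metis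
  moreover have "w \<in> M" unfolding w_def using MM zM by metis
  ultimately have "(w * (\<alpha>\<^sup>2 * \<beta>)) / (w * c) \<in> M" using MM cM(1) by metis
  moreover have "(w * (\<alpha>\<^sup>2 * \<beta>)) / (w * c) = \<alpha>"
    using w_neq_0 \<alpha>_neq_0 \<beta>_neq_0 unfolding \<alpha>\<beta>[symmetric] by (simp add: power2_eq_square)
  ultimately have aM: "\<alpha> \<in> M" by simp
  have "\<beta> = c / \<alpha>" using \<alpha>_neq_0 unfolding \<alpha>\<beta>[symmetric] by simp
  hence bM: "\<beta> \<in> M" using subfield_divide[OF M cM(1) aM] by simp
  fix x assume "x \<in> F"
  hence "x \<in> M" using splitting_field_subset[OF M KM aM bM zM] by blast
  thus "\<sigma> x = \<tau> x" by (simp add: M_def)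
qed

section \<open>Roots in the base field and the image of the Galois group\<close>

lemma cube_root_iff: "cube_root_in_base b \<longleftrightarrow> (\<exists>x\<in>{c, \<zeta> * c, \<zeta>\<^sup>2 * c}. x \<in> base_field)"
  unfolding cube_root_in_base_def c3[symmetric] cube_eq_iff by blast

lemma irreducible_R_iff: "Factorial_Ring.irreducible R \<longleftrightarrow> \<not> (\<exists>x\<in>{t0, t1, t2}. x \<in> base_field)"
proof -
  have root: "poly R x \<noteq> 0 \<longleftrightarrow> to_ac x \<notin> {t0, t1, t2}" for x
    using T.root_iff[of "to_ac x"] by (simp only: poly_map_poly_to_ac to_ac_eq_0_iff not_not)
  have "Factorial_Ring.irreducible R \<longleftrightarrow> (\<forall>x. poly R x \<noteq> 0)" by (rule irreducible_cubic_iff) simp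
  also have "\<dots> \<longleftrightarrow> \<not> (\<exists>x\<in>{t0, t1, t2}. x \<in> base_field)" unfolding root by (metis rangeE rangeI)
  finally show ?thesis .
qed

lemma not_both_reducible: "\<not> (c \<in> base_field \<and> t0 \<in> base_field)"
proof
  assume "c \<in> base_field \<and> t0 \<in> base_field"
  then obtain c' t' where c': "c = to_ac c'" and t': "t0 = to_ac t'" by blast
  define m where "m = t' / c'"
  have "t0 = c * (\<alpha> + \<beta>)" unfolding t0_def \<alpha>\<beta>[symmetric] by Groebner_Basis.algebra
  hence m: "to_ac m = \<alpha> + \<beta>" using c_neq_0 by (simp add: m_def flip: c' t')
  have "to_ac b = to_ac (c' ^ 3)" using c3 c' by simp
  hence b: "b = c' ^ 3" by (simp only: to_ac_eq_iff)
  have "\<alpha> ^ 3 + \<beta> ^ 3 = (\<alpha> + \<beta>) ^ 3 - 3 * (\<alpha> * \<beta>) * (\<alpha> + \<beta>)" by Groebner_Basis.algebra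
  hence "- to_ac a = to_ac (m ^ 3 - 3 * c' * m)" unfolding sum_cubes \<alpha>\<beta> m[symmetric] c' by simp
  hence "to_ac a = to_ac (3 * c' * m - m ^ 3)" by (metis minus_diff_eq minus_minus to_ac_minus)
  hence a: "a = 3 * c' * m - m ^ 3" by (simp only: to_ac_eq_iff)
  have "f = [:c', - m, 1:] * [:c'\<^sup>2, m * c', m\<^sup>2 - c', m, 1:]"
    unfolding a b by (rule sextic_factors_over_quadratic)
  from irreducible_field_poly_factor[OF irr this] show False by simp
qed


text \<open>The two assumptions place a root in \<open>K\<close>, if there is one, at index 0. Every
  automorphism then fixes this index, so the \<open>T\<close> flags of the factors are exactly the
  solvability of the two cubics in \<open>K\<close>.\<close>

lemma galois_group_iso:
  assumes cK: "cube_root_in_base b \<Longrightarrow> c \<in> base_field"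
    and tK: "\<not> Factorial_Ring.irreducible R \<Longrightarrow> t0 \<in> base_field"
  shows "G \<cong> D3_sub (\<zeta> \<in> base_field) (cube_root_in_base b)
    \<times>\<times> D3_sub (is_square (- 3 * (a\<^sup>2 - 4 * b))) (\<not> Factorial_Ring.irreducible R)"
proof -
  define h where "h \<sigma> = (C.label \<sigma>, T.label \<sigma>)" for \<sigma>
  interpret GG: group G by (rule galois_group_group)
  note gS = galois_groupD[OF _ subfield_splitting_field]
  have h_mult: "h (\<sigma> \<otimes>\<^bsub>G\<^esub> \<tau>) = h \<sigma> \<otimes>\<^bsub>dihedral_group 3 \<times>\<times> dihedral_group 3\<^esub> h \<tau>"
    if "\<sigma> \<in> carrier G" "\<tau> \<in> carrier G" for \<sigma> \<tau>
    unfolding h_def using C.label_mult[OF that] T.label_mult[OF that] by simp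
  have H: "h ` carrier G = D3_subset (\<zeta> \<in> base_field) (cube_root_in_base b)
      \<times> D3_subset (is_square (- 3 * (a\<^sup>2 - 4 * b))) (\<not> Factorial_Ring.irreducible R)"
  proof (rule D3_square_subset_eq)
    show "h ` carrier G \<subseteq> carrier (dihedral_group 3 \<times>\<times> dihedral_group 3)"
      using C.label(1) T.label(1) by (auto simp: h_def)
    fix x y assume "x \<in> h ` carrier G" "y \<in> h ` carrier G"
    then obtain \<sigma> \<tau> where st: "\<sigma> \<in> carrier G" "\<tau> \<in> carrier G" "x = h \<sigma>" "y = h \<tau>" by blast
    show "x \<otimes>\<^bsub>dihedral_group 3 \<times>\<times> dihedral_group 3\<^esub> y \<in> h ` carrier G"
      unfolding st h_mult[OF st(1,2), symmetric] using GG.m_closed[OF st(1,2)] by blast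
  next
    show "\<zeta> \<in> base_field \<longleftrightarrow> (\<forall>x\<in>h ` carrier G. \<not> snd (fst x))"
      unfolding zeta_base_iff h_def by simp
    show "is_square (- 3 * (a\<^sup>2 - 4 * b)) \<longleftrightarrow> (\<forall>x\<in>h ` carrier G. \<not> snd (snd x))"
      unfolding square_iff h_def by simp
    show "\<exists>x\<in>h ` carrier G. snd (fst x) \<noteq> snd (snd x)"
      using exists_separating unfolding h_def by simp
    show "\<forall>x\<in>h ` carrier G. fst (fst x) = 0" if "cube_root_in_base b"
      using gS(2)[OF _ cK[OF that]] C.label_fst_eq_0_iff by (simp add: h_def)
    show "\<forall>x\<in>h ` carrier G. fst (snd x) = 0" if "\<not> Factorial_Ring.irreducible R"
      using gS(2)[OF _ tK[OF that]] T.label_fst_eq_0_iff by (simp add: h_def)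
    fix i :: int assume i: "i \<in> {0..<3}"
    show "\<exists>x\<in>h ` carrier G. dihedral_act (fst x) i mod 3 \<noteq> i" if "\<not> cube_root_in_base b"
    proof -
      have "C.e i \<notin> base_field" using that tri_cases[of c "\<zeta> * c" "\<zeta>\<^sup>2 * c" i] unfolding cube_root_iff by blast
      from C.exists_moving[OF tri_cases this] obtain \<sigma> where s: "\<sigma> \<in> carrier G" "\<sigma> (C.e i) \<noteq> C.e i" ..
      hence "dihedral_act (fst (h \<sigma>)) i mod 3 \<noteq> i" using C.label_act_iff[OF s(1) i] by (simp add: h_def)
      thus ?thesis using s(1) by blast
    qed
    show "\<exists>x\<in>h ` carrier G. dihedral_act (snd x) i mod 3 \<noteq> i" if "\<not> \<not> Factorial_Ring.irreducible R"
    proof -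
      have "T.e i \<notin> base_field" using that tri_cases[of t0 t1 t2 i] unfolding irreducible_R_iff by blast
      from T.exists_moving[OF tri_cases this] obtain \<sigma> where s: "\<sigma> \<in> carrier G" "\<sigma> (T.e i) \<noteq> T.e i" ..
      hence "dihedral_act (snd (h \<sigma>)) i mod 3 \<noteq> i" using T.label_act_iff[OF s(1) i] by (simp add: h_def)
      thus ?thesis using s(1) by blast
    qed
  qed
  let ?P = "D3_sub (\<zeta> \<in> base_field) (cube_root_in_base b)
    \<times>\<times> D3_sub (is_square (- 3 * (a\<^sup>2 - 4 * b))) (\<not> Factorial_Ring.irreducible R)"
  have "h \<in> hom G ?P"
  proof (rule homI)
    show "h \<sigma> \<in> carrier ?P" if "\<sigma> \<in> carrier G" for \<sigma>
      using imageI[OF that, of h] unfolding H by simp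
    show "h (\<sigma> \<otimes>\<^bsub>G\<^esub> \<tau>) = h \<sigma> \<otimes>\<^bsub>?P\<^esub> h \<tau>" if "\<sigma> \<in> carrier G" "\<tau> \<in> carrier G" for \<sigma> \<tau>
      unfolding h_mult[OF that] by (simp add: h_def)
  qed
  moreover have "inj_on h (carrier G)"
    using labels_inj by (auto simp: inj_on_def h_def)
  hence "bij_betw h (carrier G) (carrier ?P)"
    unfolding bij_betw_def H by simp
  ultimately have "h \<in> iso G ?P" by (simp add: iso_def)
  thus ?thesis unfolding is_iso_def by blast
qed

text \<open>If both held, every sign would be even in both components, against
  \<open>exists_separating\<close>. Hence \<open>\<zeta> \<in> K\<close> already decides the square
  condition, which is why case 3 of the theorem does not mention it.\<close>

lemma not_zeta_and_square: "\<not> (\<zeta> \<in> base_field \<and> is_square (- 3 * (a\<^sup>2 - 4 * b)))"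
  using exists_separating unfolding zeta_base_iff square_iff by blast

end

text \<open>Starting from arbitrary \<open>\<alpha>\<close> and \<open>\<beta>\<close> would leave
  it to chance whether \<open>c\<close> and \<open>t0\<close> are the roots lying in
  \<open>K\<close>. So a cube root of \<open>b\<close> and a root of \<open>R\<close> are chosen,
  inside \<open>K\<close> where possible, and \<open>\<alpha>\<close> and \<open>\<beta>\<close> are
  solved for.\<close>

lemma sextic_roots_exist:
  fixes a b :: "'a::field"
  assumes irr: "Factorial_Ring.irreducible [:b, 0, 0, a, 0, 0, 1:]"
  obtains c \<alpha> \<beta> :: "'a alg_closure" where
    "\<alpha> * \<beta> = c" "c ^ 3 = to_ac b" "\<alpha> ^ 3 + \<beta> ^ 3 = - to_ac a"
    "cube_root_in_base b \<longrightarrow> c \<in> base_field"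
    "\<not> Factorial_Ring.irreducible [:a * b, - 3 * b, 0, 1:] \<longrightarrow> \<alpha>\<^sup>2 * \<beta> + \<alpha> * \<beta>\<^sup>2 \<in> base_field"
proof -
  let ?R = "[:a * b, - 3 * b, 0, 1:]"
  obtain c where c: "c ^ 3 = to_ac b" "cube_root_in_base b \<Longrightarrow> c \<in> base_field"
  proof (cases "cube_root_in_base b")
    case False
    obtain c where "poly [:- to_ac b, 0, 0, 1:] c = 0"
      using alg_closed_imp_poly_has_root[of "[:- to_ac b, 0, 0, 1:]"] by auto
    thus ?thesis using that[of c] False by (simp add: power3_eq_cube mult.assoc)
  qed (use that in \<open>auto simp: cube_root_in_base_def\<close>)
  obtain t where t: "poly (map_poly to_ac ?R) t = 0" "\<not> Factorial_Ring.irreducible ?R \<Longrightarrow> t \<in> base_field"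
  proof (cases "Factorial_Ring.irreducible ?R")
    case True
    obtain t where "poly (map_poly to_ac ?R) t = 0"
      using alg_closed_imp_poly_has_root[of "map_poly to_ac ?R"] by (auto simp: map_poly_pCons)
    thus ?thesis using that[of t] True by blast
  next
    case False
    have "degree ?R = 3" by simp
    then obtain x where "poly ?R x = 0" using irreducible_cubic_iff[of ?R] False by blast
    hence "poly (map_poly to_ac ?R) (to_ac x) = 0" by (simp only: poly_map_poly_to_ac to_ac_0)
    thus ?thesis using that[of "to_ac x"] by blast
  qed
  have c0: "c \<noteq> 0" using c(1) irreducible_sextic_constant[OF irr] by auto
  \<comment> \<open>\<open>t\<close> has to be \<open>c (\<alpha> + \<beta>)\<close>, so \<open>\<alpha>\<close> and \<open>\<beta>\<close> are the roots of \<open>x\<^sup>2 - (t / c) x + c\<close>\<close>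
  define m where "m = t / c"
  obtain \<alpha> where \<alpha>: "poly [:c, - m, 1:] \<alpha> = 0" using alg_closed_imp_poly_has_root[of "[:c, - m, 1:]"] by auto
  define \<beta> where "\<beta> = m - \<alpha>"
  have p: "\<alpha> * \<beta> = c" using \<alpha> unfolding \<beta>_def by (simp add: algebra_simps eq_neg_iff_add_eq_0)
  have tm: "t = m * c" using c0 by (simp add: m_def)
  have "t ^ 3 - 3 * to_ac b * t + to_ac a * to_ac b = 0"
    using t(1) by (simp add: map_poly_pCons algebra_simps power3_eq_cube)
  \<comment> \<open>As \<open>b = c ^ 3\<close>, each term of \<open>R\<close> evaluated at
    \<open>m * c\<close> carries the factor \<open>c ^ 3\<close>. The cofactor is the condition on
    the sum of cubes, because \<open>m ^ 3 - 3 * c * m = \<alpha> ^ 3 + \<beta> ^ 3\<close>.\<close>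
  hence "c ^ 3 * (m ^ 3 - 3 * c * m + to_ac a) = 0" unfolding tm c(1)[symmetric] by Groebner_Basis.algebra
  hence "m ^ 3 - 3 * c * m + to_ac a = 0" using c0 by simp
  hence "\<alpha> ^ 3 + \<beta> ^ 3 = - to_ac a" unfolding p[symmetric] \<beta>_def by Groebner_Basis.algebra
  moreover have "\<alpha>\<^sup>2 * \<beta> + \<alpha> * \<beta>\<^sup>2 = t"
    unfolding tm p[symmetric] \<beta>_def by Groebner_Basis.algebra
  ultimately show ?thesis using c(2) t(2) by (intro that[OF p c(1)]) simp_all
qed

theorem theorem1p1:
  fixes a b \<Delta> :: "'a::field"
    and f R :: "'a poly"
    and F :: "'a alg_closure set"
    and G :: "('a alg_closure \<Rightarrow> 'a alg_closure) monoid"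
    and \<zeta> :: "'a alg_closure"
  assumes char: "CHAR('a) \<noteq> 2"
    and f: "f = [:b, 0, 0, a, 0, 0, 1:]"
    and irreducible_f: "Factorial_Ring.irreducible f"
    and separable_f: "separable f"
    and \<Delta>: "\<Delta> = a\<^sup>2 - 4 * b"
    and R: "R = [:a * b, - 3 * b, 0, 1:]"
    and F: "F = splitting_field f"
    and G: "G = galois_group closure_ring F base_field"
    and \<zeta>: "primitive_root_of_unity 3 \<zeta>"
  shows
    "(\<zeta> \<notin> base_field \<and> \<not> is_square (- 3 * \<Delta>) \<longrightarrow>
        (cube_root_in_base b \<or> \<not> Factorial_Ring.irreducible R \<longrightarrow>
           G \<cong> dihedral_group 6) \<and>
        (\<not> cube_root_in_base b \<and> Factorial_Ring.irreducible R \<longrightarrow>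
           G \<cong> sym_group 3 \<times>\<times> sym_group 3)) \<and>
     (\<zeta> \<notin> base_field \<and> is_square (- 3 * \<Delta>) \<longrightarrow>
        (cube_root_in_base b \<and> Factorial_Ring.irreducible R \<longrightarrow>
           G \<cong> integer_mod_group 6) \<and>
        (\<not> cube_root_in_base b \<and> \<not> Factorial_Ring.irreducible R \<longrightarrow>
           G \<cong> sym_group 3) \<and>
        (\<not> cube_root_in_base b \<and> Factorial_Ring.irreducible R \<longrightarrow>
           G \<cong> integer_mod_group 3 \<times>\<times> sym_group 3)) \<and>
     (\<zeta> \<in> base_field \<longrightarrow>
        (cube_root_in_base b \<and> Factorial_Ring.irreducible R \<longrightarrow>
           G \<cong> sym_group 3) \<and>
        (\<not> cube_root_in_base b \<and> \<not> Factorial_Ring.irreducible R \<longrightarrow>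
           G \<cong> integer_mod_group 6) \<and>
        (\<not> cube_root_in_base b \<and> Factorial_Ring.irreducible R \<longrightarrow>
           G \<cong> integer_mod_group 3 \<times>\<times> sym_group 3)) \<and>
     ((\<zeta> \<notin> base_field \<and> \<not> is_square (- 3 * \<Delta>) \<and>
         ((cube_root_in_base b \<or> \<not> Factorial_Ring.irreducible R) \<or>
          (\<not> cube_root_in_base b \<and> Factorial_Ring.irreducible R))) \<or>
      (\<zeta> \<notin> base_field \<and> is_square (- 3 * \<Delta>) \<and>
         ((cube_root_in_base b \<and> Factorial_Ring.irreducible R) \<or>
          (\<not> cube_root_in_base b \<and> \<not> Factorial_Ring.irreducible R) \<or>
          (\<not> cube_root_in_base b \<and> Factorial_Ring.irreducible R))) \<or>
      (\<zeta> \<in> base_field \<and>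
         ((cube_root_in_base b \<and> Factorial_Ring.irreducible R) \<or>
          (\<not> cube_root_in_base b \<and> \<not> Factorial_Ring.irreducible R) \<or>
          (\<not> cube_root_in_base b \<and> Factorial_Ring.irreducible R))))"
proof -
  define Z Q B I where "Z \<longleftrightarrow> \<zeta> \<in> base_field" and "Q \<longleftrightarrow> is_square (- 3 * \<Delta>)"
    and "B \<longleftrightarrow> cube_root_in_base b" and "I \<longleftrightarrow> Factorial_Ring.irreducible R"
  obtain c \<alpha> \<beta> :: "'a alg_closure" where
    roots: "\<alpha> * \<beta> = c" "c ^ 3 = to_ac b" "\<alpha> ^ 3 + \<beta> ^ 3 = - to_ac a"
    and cK: "cube_root_in_base b \<longrightarrow> c \<in> base_field"
    and tK: "\<not> Factorial_Ring.irreducible [:a * b, - 3 * b, 0, 1:] \<longrightarrow> \<alpha>\<^sup>2 * \<beta> + \<alpha> * \<beta>\<^sup>2 \<in> base_field"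
    by (rule sextic_roots_exist[OF irreducible_f[unfolded f]])
  interpret sextic a b \<zeta> c \<alpha> \<beta>
    by unfold_locales (fact char irreducible_f[unfolded f] \<zeta> roots)+
  note cK' = mp[OF cK] and tK' = mp[OF tK[folded t0_def]]
  have G: "G \<cong> D3_sub Z B \<times>\<times> D3_sub Q (\<not> I)"
    unfolding G F f Z_def Q_def B_def I_def \<Delta> R by (rule galois_group_iso[OF cK' tK'])
  \<comment> \<open>\<open>ZQ\<close> and \<open>BI\<close> leave nine of the sixteen combinations
    of flags, which are the ones treated in the theorem.\<close>
  have ZQ: "\<not> (Z \<and> Q)" unfolding Z_def Q_def \<Delta> by (rule not_zeta_and_square)
  have BI: "\<not> (B \<and> \<not> I)" using cK' tK' not_both_reducible unfolding B_def I_def R by blast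
  \<comment> \<open>The flags of the two cubics enter symmetrically, so each product of standard
    subgroups is identified in one order only and transferred to the other by commuting the
    factors.\<close>
  note swap = iso_trans[OF DirProd_commute_iso]
  have D6: "G \<cong> dihedral_group 6" if "\<not> Z" "\<not> Q" "B \<or> \<not> I"
  proof (cases B)
    case True
    thus ?thesis using iso_trans[OF G] that BI D3_sub_iso_dihedral_group_6 by simp
  next
    case False
    thus ?thesis using iso_trans[OF G] that swap[OF D3_sub_iso_dihedral_group_6] by simp
  qed
  have S3_S3: "G \<cong> sym_group 3 \<times>\<times> sym_group 3" if "\<not> Z" "\<not> Q" "\<not> B" "I"
    using iso_trans[OF G] that
      group.DirProd_iso_trans[OF group_D3_sub D3_sub_iso_sym_group_3 D3_sub_iso_sym_group_3] by simp
  have C6: "G \<cong> integer_mod_group 6" if "\<not> Z \<and> Q \<and> B \<and> I \<or> Z \<and> \<not> Q \<and> \<not> B \<and> \<not> I"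
  proof (cases Z)
    case True
    hence "\<not> Q" "\<not> B" "\<not> I" using that by blast+
    thus ?thesis using iso_trans[OF G] True swap[OF D3_sub_iso_integer_mod_group_6] by simp
  next
    case False
    hence "Q" "B" "I" using that by blast+
    thus ?thesis using iso_trans[OF G] False D3_sub_iso_integer_mod_group_6 by simp
  qed
  have S3: "G \<cong> sym_group 3" if "\<not> Z \<and> Q \<and> \<not> B \<and> \<not> I \<or> Z \<and> \<not> Q \<and> B \<and> I"
  proof -
    note iso = iso_trans[OF D3_sub_trivial_DirProd_iso D3_sub_iso_sym_group_3]
    show ?thesis
    proof (cases Z)
      case True
      hence "\<not> Q" "B" "I" using that by blast+
      thus ?thesis using iso_trans[OF G] True iso by simp
    next
      case False
      hence "Q" "\<not> B" "\<not> I" using that by blast+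
      thus ?thesis using iso_trans[OF G] False swap[OF iso] by simp
    qed
  qed
  have C3_S3: "G \<cong> integer_mod_group 3 \<times>\<times> sym_group 3" if "\<not> Z \<and> Q \<and> \<not> B \<and> I \<or> Z \<and> \<not> Q \<and> \<not> B \<and> I"
  proof -
    note iso = group.DirProd_iso_trans[OF group_D3_sub D3_sub_iso_integer_mod_group_3 D3_sub_iso_sym_group_3]
    show ?thesis
    proof (cases Z)
      case True
      hence "\<not> Q" "\<not> B" "I" using that by blast+
      thus ?thesis using iso_trans[OF G] True iso by simp
    next
      case False
      hence "Q" "\<not> B" "I" using that by blast+
      thus ?thesis using iso_trans[OF G] False swap[OF iso] by simp
    qed
  qed
  show ?thesis
    unfolding Z_def[symmetric] Q_def[symmetric] B_def[symmetric] I_def[symmetric]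
    using D6 S3_S3 C6 S3 C3_S3 ZQ BI by (cases Z; cases Q; cases B; cases I; simp)
qed

end
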